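(* For each $(i,j)$ with $1\le i\le r$ and $1\le j\le k_i$, choose an element $t$ (depending on $i,j$) of the cycle $e_{i,j}$, and let $\delta_{i,j}\in R$ be such that $\tau(\delta_{i,j})$ maps $1$ to $t$. For $1\le i\le r-1$ and $1\le j\le k_i$ put $E_{i,j}=\delta_{i,j}\gamma_i^{\ell_{i,j}}\delta_{i,j}^{-1}\in H=\pi_1(X^{\rm op},z_1)$, and for $1\le j\le k_r$ put $W_j=\delta_{r,j}\gamma_r^{\ell_{r,j}}\delta_{r,j}^{-1}=\delta_{r,j}(\gamma_{r-1}^{-1}\gamma_{r-2}^{-1}\cdots\gamma_1^{-1})^{\ell_{r,j}}\delta_{r,j}^{-1}\in H$. Then the subgroup $\mathcal N\lhd \pi_1(X^{\rm op},z_1)$ equals the normal subgroup of $\pi_1(X^{\rm op},z_1)$ generated by all the words $E_{i,j}$ ($1\le i\le r-1$, $1\le j\le k_i$) and $W_1,\dots,W_{k_r}$. Moreover, writing these elements as reduced words in the basis $Y_R$ of $\pi_1(X^{\rm op},z_1)$, for each $y\in Y_R$, the letter $y$ appears in exactly one of the $E_{i,j}$ and $y^{-1}$ appears in exactly one of the $W_j$.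
   Context: Setup. $X$ is a compact (connected) Riemann surface, $f:X\to\mathbb{CP}^1$ is a branched cover of degree $n>1$ with set of branch points $B=\{b_1,\dots,b_r\}$, $Z=\mathbb{CP}^1\setminus B$, $z\in Z$, and $f^{-1}(z)=\{z_1,\dots,z_n\}$ with a fixed labelling; $X^{\rm op}=X\setminus f^{-1}(B)$, so $f:X^{\rm op}\to Z$ is a covering of degree $n$. For each $i$, $\gamma_i\in\pi_1(Z,z)$ is the class of a loop around $b_i$ only, chosen so that $G:=\pi_1(Z,z)=\langle\gamma_1,\dots,\gamma_r\mid \gamma_1\cdots\gamma_r=1\rangle$; thus $G$ is free with basis $S=\{\gamma_1,\dots,\gamma_{r-1}\}$ and $\gamma_r=(\gamma_1\cdots\gamma_{r-1})^{-1}$. The permutation representation $\tau:G\to S_n$ is defined by $\tau(\gamma)(i)=j$ if the lift of $\gamma$ starting at $z_i$ ends at $z_j$ (paths and permutations are composed from left to right, so $\tau$ is a homomorphism). Via $f_*$, identify $\pi_1(X^{\rm op},z_1)$ with $H=\tau^{-1}(\mathrm{Stab}(1))\le G$, which has index $n$. The labelling of $f^{-1}(z)$ is chosen so that $\gamma_1\notin H$. For $1\le i\le r$ write $\sigma_i=\tau(\gamma_i)=e_{i,1}e_{i,2}\cdots e_{i,k_i}$ as a product of disjoint cycles (cycles of length 1 included), and let $\ell_{i,j}$ be the length of $e_{i,j}$; "$t\in e_{i,j}$" means that $t\in\{1,\dots,n\}$ is moved along (or is the unique point of) the cycle $e_{i,j}$. Schreier basis. Order $S\cup S^{-1}$ by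 $\gamma_1<\gamma_1^{-1}<\gamma_2<\gamma_2^{-1}<\dots<\gamma_{r-1}<\gamma_{r-1}^{-1}$ and well-order $G$ by length of the reduced word in $S\cup S^{-1}$, ties being broken lexicographically. For $g\in G$ let $\rho(g)=\min(Hg)$, and let $R=\rho(G)$ (the Schreier transversal), which contains exactly one element of each right coset $Hg$. For $x\in R$, $s\in S$ let $\phi_R(x,s)=xs\rho(xs)^{-1}\in H$. Then $Y_R=\{\phi_R(x,s)\mid x\in R, s\in S\}\setminus\{1\}$ is a basis of the free group $H$. Definition of $\mathcal N$. For each cycle $e_{i,j}$ ($1\le i\le r$, $1\le j\le k_i$) choose $k\in e_{i,j}$ and any path $\beta_{i,j}$ in $X^{\rm op}$ from $z_1$ to $z_k$; let $\widetilde{\gamma_i^{\ell_{i,j}}}^{\,k}$ be the lift to $X^{\rm op}$ of $\gamma_i^{\ell_{i,j}}$ starting at $z_k$ (it is a loop). $\mathcal N$ is the normal subgroup of $\pi_1(X^{\rm op},z_1)$ generated by all the elements $\beta_{i,j}\,\widetilde{\gamma_i^{\ell_{i,j}}}^{\,k}\beta_{i,j}^{-1}$ (it does not depend on the choices), and $\pi_1(X,z_1)\cong\pi_1(X^{\rm op},z_1)/\mathcal N$. *)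

theory Defs
  imports
    "HOL-Complex_Analysis.Complex_Analysis"
    "HOL-Algebra.Coset"
    "HOL-Combinatorics.Cycles"
begin

definition proportional :: "complex \<times> complex \<Rightarrow> complex \<times> complex \<Rightarrow> bool" where
  "proportional v w \<longleftrightarrow> v \<noteq> 0 \<and> (\<exists>c. c \<noteq> 0 \<and> w = (c * fst v, c * snd v))"

quotient_type cp1 = "complex \<times> complex" / partial: proportional
proof (rule part_equivpI)
  have "proportional (1, 0) (1, 0)"
    unfolding proportional_def by (auto simp: zero_prod_def intro: exI[of _ 1])
  then show "\<exists>v. proportional v v" ..
  show "symp proportional"
  proof (rule sympI)
    fix v w assume "proportional v w"
    then obtain c where c: "c \<noteq> 0" "w = (c * fst v, c * snd v)" and v: "v \<noteq> 0"
      by (auto simp: proportional_def)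
    have "w \<noteq> 0" using c v by (auto simp: zero_prod_def prod_eq_iff)
    moreover have "v = (inverse c * fst w, inverse c * snd w)"
      using c by (simp add: prod_eq_iff)
    ultimately show "proportional w v"
      using c(1) unfolding proportional_def by (metis nonzero_imp_inverse_nonzero)
  qed
  show "transp proportional"
  proof (rule transpI)
    fix u v w assume "proportional u v" "proportional v w"
    then obtain c d where "u \<noteq> 0" "c \<noteq> 0" "v = (c * fst u, c * snd u)"
        "d \<noteq> 0" "w = (d * fst v, d * snd v)"
      by (auto simp: proportional_def)
    then show "proportional u w"
      unfolding proportional_def by (intro conjI exI[of _ "d * c"]) auto
  qed
qed

text \<open>\<open>abs_cp1 (a, b)\<close> is the point with homogeneous coordinates \<open>[a : b]\<close>.
  The topology is the quotient topology of the nonzero vectors.\<close>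

instantiation cp1 :: topological_space
begin

definition open_cp1 :: "cp1 set \<Rightarrow> bool" where
  "open_cp1 U \<longleftrightarrow> open {v. v \<noteq> 0 \<and> abs_cp1 v \<in> U}"

instance
proof
  have "{v. v \<noteq> 0 \<and> abs_cp1 v \<in> UNIV} = - {0}" by auto
  then show "open (UNIV :: cp1 set)"
    by (simp only: open_cp1_def) (rule open_Compl, rule closed_singleton)
next
  fix S T :: "cp1 set" assume "open S" "open T"
  moreover have "{v. v \<noteq> 0 \<and> abs_cp1 v \<in> S \<inter> T} =
      {v. v \<noteq> 0 \<and> abs_cp1 v \<in> S} \<inter> {v. v \<noteq> 0 \<and> abs_cp1 v \<in> T}" by blast
  ultimately show "open (S \<inter> T)"
    by (simp only: open_cp1_def) (rule open_Int)
next
  fix K :: "cp1 set set" assume K: "\<forall>S\<in>K. open S"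
  have "{v. v \<noteq> 0 \<and> abs_cp1 v \<in> \<Union>K} = (\<Union>S\<in>K. {v. v \<noteq> 0 \<and> abs_cp1 v \<in> S})" by blast
  moreover have "open (\<Union>S\<in>K. {v. v \<noteq> 0 \<and> abs_cp1 v \<in> S})"
    by (rule open_UN) (use K in \<open>simp only: open_cp1_def\<close>)
  ultimately show "open (\<Union>K)" by (simp only: open_cp1_def)
qed

end

lift_definition affine_coord :: "cp1 \<Rightarrow> complex" is "\<lambda>(a, b). a / b"
  by (auto simp: proportional_def)

lift_definition affine_coord_inf :: "cp1 \<Rightarrow> complex" is "\<lambda>(a, b). b / a"
  by (auto simp: proportional_def)

definition cp1_atlas :: "(cp1 set \<times> (cp1 \<Rightarrow> complex)) set" where
  "cp1_atlas = {(- {abs_cp1 (1, 0)}, affine_coord), (- {abs_cp1 (0, 1)}, affine_coord_inf)}"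

text \<open>The Hausdorff axiom is carried by the type class. No maximality is required of the atlas.\<close>

definition riemann_surface :: "'a::t2_space set \<Rightarrow> ('a set \<times> ('a \<Rightarrow> complex)) set \<Rightarrow> bool" where
  "riemann_surface X A \<longleftrightarrow>
     connected X \<and> X = \<Union>(fst ` A) \<and>
     (\<forall>(U, \<phi>) \<in> A. openin (top_of_set X) U \<and> (\<exists>V \<psi>. open V \<and> homeomorphism U V \<phi> \<psi>)) \<and>
     (\<forall>(U, \<phi>) \<in> A. \<forall>(V, \<psi>) \<in> A. (\<psi> \<circ> inv_into U \<phi>) holomorphic_on (\<phi> ` (U \<inter> V)))"

definition holomorphic_map ::
  "'a::topological_space set \<Rightarrow> ('a set \<times> ('a \<Rightarrow> complex)) set \<Rightarrow>
   'b::topological_space set \<Rightarrow> ('b set \<times> ('b \<Rightarrow> complex)) set \<Rightarrow> ('a \<Rightarrow> 'b) \<Rightarrow> bool" where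
  "holomorphic_map X A Y B f \<longleftrightarrow>
     continuous_on X f \<and> f ` X \<subseteq> Y \<and>
     (\<forall>(U, \<phi>) \<in> A. \<forall>(V, \<psi>) \<in> B.
        (\<psi> \<circ> f \<circ> inv_into U \<phi>) holomorphic_on (\<phi> ` (U \<inter> f -` V)))"

definition ramification_points ::
  "'a::topological_space set \<Rightarrow> ('a \<Rightarrow> 'b) \<Rightarrow> 'a set" where
  "ramification_points X f =
     {x \<in> X. \<not> (\<exists>U. openin (top_of_set X) U \<and> x \<in> U \<and> inj_on f U)}"

definition branch_points :: "'a::topological_space set \<Rightarrow> ('a \<Rightarrow> 'b) \<Rightarrow> 'b set" where
  "branch_points X f = f ` ramification_points X f"

text \<open>The covering property is part of the notion of a branched cover of degree \<open>n\<close>; it includes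
  surjectivity onto the complement of the branch points.\<close>

definition branched_cover ::
  "'a::t2_space set \<Rightarrow> ('a set \<times> ('a \<Rightarrow> complex)) set \<Rightarrow> ('a \<Rightarrow> cp1) \<Rightarrow> nat \<Rightarrow> bool" where
  "branched_cover X A f n \<longleftrightarrow>
     holomorphic_map X A UNIV cp1_atlas f \<and>
     finite (branch_points X f) \<and>
     covering_space (X - f -` branch_points X f) f (- branch_points X f) \<and>
     (\<forall>w \<in> - branch_points X f. card (X \<inter> f -` {w}) = n)"

definition path_class :: "'a::topological_space set \<Rightarrow> (real \<Rightarrow> 'a) \<Rightarrow> (real \<Rightarrow> 'a) set" where
  "path_class S p = {q. homotopic_paths S p q}"

definition fundamental_group :: "'a::topological_space set \<Rightarrow> 'a \<Rightarrow> (real \<Rightarrow> 'a) set monoid" where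
  "fundamental_group S x =
     \<lparr>carrier = path_class S `
        {p. path p \<and> path_image p \<subseteq> S \<and> pathstart p = x \<and> pathfinish p = x},
      mult = (\<lambda>a b. {h. \<exists>p\<in>a. \<exists>q\<in>b. homotopic_paths S (p +++ q) h}),
      one = path_class S (\<lambda>_. x)\<rparr>"

definition induced_map ::
  "'b::topological_space set \<Rightarrow> ('a \<Rightarrow> 'b) \<Rightarrow> (real \<Rightarrow> 'a) set \<Rightarrow> (real \<Rightarrow> 'b) set" where
  "induced_map T f a = {h. \<exists>p\<in>a. homotopic_paths T (f \<circ> p) h}"

text \<open>\<open>q\<close> is the lift, starting at \<open>x\<close>, of some representative of the class \<open>g\<close>.\<close>

definition is_lift ::
  "'a::topological_space set \<Rightarrow> ('a \<Rightarrow> 'b) \<Rightarrow> (real \<Rightarrow> 'b) set \<Rightarrow> 'a \<Rightarrow> (real \<Rightarrow> 'a) \<Rightarrow> bool" where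
  "is_lift C f g x q \<longleftrightarrow> path q \<and> path_image q \<subseteq> C \<and> pathstart q = x \<and> f \<circ> q \<in> g"

definition monodromy ::
  "'a::topological_space set \<Rightarrow> ('a \<Rightarrow> 'b) \<Rightarrow> nat \<Rightarrow> (nat \<Rightarrow> 'a) \<Rightarrow> (real \<Rightarrow> 'b) set \<Rightarrow> nat \<Rightarrow> nat" where
  "monodromy C f n zs g i =
     (if i \<in> {1..n}
      then THE j. j \<in> {1..n} \<and> (\<exists>q. is_lift C f g (zs i) q \<and> pathfinish q = zs j)
      else i)"

text \<open>The class \<open>g\<close> is represented by a path followed by the boundary circle of a coordinate disc
  that meets \<open>B\<close> in \<open>b\<close> only, and by the path back. Either orientation of the circle is allowed.\<close>

definition loop_around_only :: "cp1 set \<Rightarrow> cp1 \<Rightarrow> cp1 \<Rightarrow> (real \<Rightarrow> cp1) set \<Rightarrow> bool" where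
  "loop_around_only B z b g \<longleftrightarrow>
     (\<exists>(U, \<phi>) \<in> cp1_atlas. \<exists>\<epsilon> > 0. \<exists>c \<alpha>.
        b \<in> U \<and> U \<inter> \<phi> -` cball (\<phi> b) \<epsilon> \<inter> B = {b} \<and>
        c \<in> {inv_into U \<phi> \<circ> circlepath (\<phi> b) \<epsilon>,
             reversepath (inv_into U \<phi> \<circ> circlepath (\<phi> b) \<epsilon>)} \<and>
        path \<alpha> \<and> path_image \<alpha> \<subseteq> - B \<and> pathstart \<alpha> = z \<and> pathfinish \<alpha> = pathstart c \<and>
        g = path_class (- B) (\<alpha> +++ c +++ reversepath \<alpha>))"

text \<open>The letter \<open>(i, True)\<close> stands for the generator \<open>g i\<close>, and \<open>(i, False)\<close> for its inverse.\<close>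

definition word_value :: "('g, 'm) monoid_scheme \<Rightarrow> ('i \<Rightarrow> 'g) \<Rightarrow> ('i \<times> bool) list \<Rightarrow> 'g" where
  "word_value G g w =
     foldr (\<lambda>(i, s) x. (if s then g i else inv\<^bsub>G\<^esub> (g i)) \<otimes>\<^bsub>G\<^esub> x) w \<one>\<^bsub>G\<^esub>"

definition reduced :: "('i \<times> bool) list \<Rightarrow> bool" where
  "reduced w \<longleftrightarrow> successively (\<lambda>a b. \<not> (fst a = fst b \<and> snd a \<noteq> snd b)) w"

definition is_reduced_word ::
  "('g, 'm) monoid_scheme \<Rightarrow> 'i set \<Rightarrow> ('i \<Rightarrow> 'g) \<Rightarrow> 'g \<Rightarrow> ('i \<times> bool) list \<Rightarrow> bool" where
  "is_reduced_word G I g x w \<longleftrightarrow> reduced w \<and> fst ` set w \<subseteq> I \<and> word_value G g w = x"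

definition free_basis :: "('g, 'm) monoid_scheme \<Rightarrow> 'i set \<Rightarrow> ('i \<Rightarrow> 'g) \<Rightarrow> bool" where
  "free_basis G I g \<longleftrightarrow>
     g ` I \<subseteq> carrier G \<and> (\<forall>x \<in> carrier G. \<exists>!w. is_reduced_word G I g x w)"

definition reduced_word ::
  "('g, 'm) monoid_scheme \<Rightarrow> 'i set \<Rightarrow> ('i \<Rightarrow> 'g) \<Rightarrow> 'g \<Rightarrow> ('i \<times> bool) list" where
  "reduced_word G I g x = (THE w. is_reduced_word G I g x w)"

definition normal_closure :: "('g, 'm) monoid_scheme \<Rightarrow> 'g set \<Rightarrow> 'g set" where
  "normal_closure G A = \<Inter>{N. N \<lhd> G \<and> A \<subseteq> N}"

definition letter_order :: "((nat \<times> bool) \<times> (nat \<times> bool)) set" where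
  "letter_order = {((i, s), (j, u)). i < j \<or> (i = j \<and> s \<and> \<not> u)}"

definition elem_less ::
  "('g, 'm) monoid_scheme \<Rightarrow> nat set \<Rightarrow> (nat \<Rightarrow> 'g) \<Rightarrow> 'g \<Rightarrow> 'g \<Rightarrow> bool" where
  "elem_less G I g x y \<longleftrightarrow> (reduced_word G I g x, reduced_word G I g y) \<in> lenlex letter_order"

definition coset_min ::
  "('g, 'm) monoid_scheme \<Rightarrow> nat set \<Rightarrow> (nat \<Rightarrow> 'g) \<Rightarrow> 'g set \<Rightarrow> 'g \<Rightarrow> 'g" where
  "coset_min G I g H x =
     (THE m. m \<in> H #>\<^bsub>G\<^esub> x \<and> (\<forall>y \<in> H #>\<^bsub>G\<^esub> x. y \<noteq> m \<longrightarrow> elem_less G I g m y))"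

definition schreier_transversal ::
  "('g, 'm) monoid_scheme \<Rightarrow> nat set \<Rightarrow> (nat \<Rightarrow> 'g) \<Rightarrow> 'g set \<Rightarrow> 'g set" where
  "schreier_transversal G I g H = coset_min G I g H ` carrier G"

definition schreier_gen ::
  "('g, 'm) monoid_scheme \<Rightarrow> nat set \<Rightarrow> (nat \<Rightarrow> 'g) \<Rightarrow> 'g set \<Rightarrow> 'g \<Rightarrow> 'g \<Rightarrow> 'g" where
  "schreier_gen G I g H x s =
     x \<otimes>\<^bsub>G\<^esub> s \<otimes>\<^bsub>G\<^esub> inv\<^bsub>G\<^esub> (coset_min G I g H (x \<otimes>\<^bsub>G\<^esub> s))"

definition schreier_basis ::
  "('g, 'm) monoid_scheme \<Rightarrow> nat set \<Rightarrow> (nat \<Rightarrow> 'g) \<Rightarrow> 'g set \<Rightarrow> 'g set" where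
  "schreier_basis G I g H =
     {schreier_gen G I g H x (g i) | x i. x \<in> schreier_transversal G I g H \<and> i \<in> I} - {\<one>\<^bsub>G\<^esub>}"

text \<open>A cycle is the list of its points in cyclic order; fixed points give lists of length 1.\<close>

definition disjoint_cycle_decomposition ::
  "nat \<Rightarrow> (nat \<Rightarrow> nat) \<Rightarrow> nat \<Rightarrow> (nat \<Rightarrow> nat list) \<Rightarrow> bool" where
  "disjoint_cycle_decomposition n \<sigma> k e \<longleftrightarrow>
     (\<forall>j \<in> {1..k}. e j \<noteq> [] \<and> distinct (e j)) \<and>
     disjoint_family_on (\<lambda>j. set (e j)) {1..k} \<and>
     (\<Union>j \<in> {1..k}. set (e j)) = {1..n} \<and>
     \<sigma> = foldr (\<lambda>j p. cycle_of_list (e j) \<circ> p) [1..<Suc k] id"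

text \<open>The lift \<open>q\<close> is unique up to homotopy, so each pair \<open>(i, j)\<close> contributes one generator.\<close>

definition puncture_kernel ::
  "'a::topological_space set \<Rightarrow> 'b::topological_space set \<Rightarrow> ('a \<Rightarrow> 'b) \<Rightarrow> 'b \<Rightarrow> (nat \<Rightarrow> 'a) \<Rightarrow>
   nat \<Rightarrow> (nat \<Rightarrow> (real \<Rightarrow> 'b) set) \<Rightarrow> (nat \<Rightarrow> nat) \<Rightarrow> (nat \<Rightarrow> nat \<Rightarrow> nat list) \<Rightarrow>
   (nat \<Rightarrow> nat \<Rightarrow> nat) \<Rightarrow> (nat \<Rightarrow> nat \<Rightarrow> real \<Rightarrow> 'a) \<Rightarrow> (real \<Rightarrow> 'a) set set" where
  "puncture_kernel C Z f z zs r \<gamma> k e u \<beta> =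
     normal_closure (fundamental_group C (zs 1))
       {path_class C (\<beta> i j +++ q +++ reversepath (\<beta> i j)) | i j q.
          i \<in> {1..r} \<and> j \<in> {1..k i} \<and>
          is_lift C f (\<gamma> i [^]\<^bsub>fundamental_group Z z\<^esub> length (e i j)) (zs (u i j)) q}"

end

theory Submission
  imports Defs
begin

text \<open>The mathematics splits into a topological translation and a computation in a free group.

\<^bold>\<open>Translation.\<close>  Lifting of paths and homotopies makes the monodromy a right action of
\<open>G = \<pi>\<^sub>1(Z, z)\<close> on the labels \<open>{1..n}\<close> of the fibre, and makes \<open>f\<^sub>*\<close> an isomorphism of
\<open>\<pi>\<^sub>1(Xop, zs 1)\<close> onto the stabilizer \<open>H\<close> of \<open>1\<close> (\<open>induced_map_iso\<close>).  The loop obtained by running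
along \<open>\<beta>\<close>, around a puncture and back has image \<open>d \<gamma>\<^sub>i\<^sup>\<ell> d\<^sup>-\<^sup>1\<close>, where \<open>d\<close> is the class of \<open>f \<circ> \<beta>\<close> and
moves \<open>1\<close> into the cycle (\<open>lasso\<close>).  Two such elements, for different \<open>d\<close> reaching the same cycle, are
conjugate by an element of \<open>H\<close> (\<open>conj_independent_of_path\<close>).  Hence replacing \<open>d\<close> by the
representative \<open>\<delta>\<close> changes the generators of the normal subgroup only up to conjugacy.
The paths \<open>\<beta>\<close> also show that the action is transitive, since each cycle of \<open>\<gamma>\<^sub>1\<close> is reached by one
of them.

\<^bold>\<open>Computation.\<close>  Represent each point \<open>p\<close> by the shortlex-least element \<open>rep p\<close> that moves \<open>1\<close> to \<open>p\<close>.
Consider the graph with vertices \<open>{1..n}\<close> and an edge labelled \<open>i\<close> from \<open>p\<close> to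
\<open>\<tau> (\<gamma> i) p\<close>.  The representatives are closed under prefixes, so they span a tree in this graph whose
edges have trivial Schreier generator.  Tracing a word in the \<open>\<gamma>\<^sub>i\<close> from \<open>p\<close> to \<open>q\<close> and recording
the proper edges crossed writes \<open>rep p \<cdot> w \<cdot> (rep q)\<^sup>-\<^sup>1\<close> in Schreier generators (\<open>trace_value\<close>).
For this expression to be the reduced word, the Schreier generators must be a free basis.  For that,
\<open>G\<close> is made to act on reduced words over the proper edges: each group element prepends, with
cancellation, the edges that it crosses.  Freeness of \<open>G\<close> makes this well defined (\<open>run_red\<close>), and a
Schreier generator acts by prepending its own edge (\<open>run_edge\<close>).  A reduced word can therefore be read
off from its value (\<open>edge_word_unique\<close>).

The word \<open>\<gamma>\<^sub>i\<^sup>\<ell>\<close> contains positive letters only, and \<open>\<gamma>\<^sub>r = \<gamma>\<^sub>r\<^sub>-\<^sub>1\<^sup>-\<^sup>1 \<cdots> \<gamma>\<^sub>1\<^sup>-\<^sup>1\<close> negative letters only, so the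
traces of \<open>E\<close> and \<open>W\<close> are reduced as they stand.  The edge labelled \<open>i\<close> at \<open>q\<close> is crossed by
\<open>E\<^sub>i\<^sub>j\<close> exactly when \<open>q\<close> lies in the \<open>j\<close>-th cycle of \<open>\<gamma>\<^sub>i\<close>, and by \<open>W\<^sub>j\<close> backwards exactly when the
image of \<open>q\<close> under a permutation depending only on \<open>i\<close> lies in the \<open>j\<close>-th cycle of \<open>\<gamma>\<^sub>r\<close>.  Cycles partition \<open>{1..n}\<close>, which gives
existence and uniqueness of \<open>(i, j)\<close> and of \<open>j\<close>.\<close>

section \<open>Letter order and free reduction of words\<close>

lemma wf_letter_order: "wf letter_order"
proof (rule wf_subset)
  show "wf (Wellfounded.measure (\<lambda>(i, s). 2 * i + (if s then 0 else 1 :: nat)))" by (rule wf_measure)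
  show "letter_order \<subseteq> Wellfounded.measure (\<lambda>(i, s). 2 * i + (if s then 0 else 1 :: nat))"
    by (auto simp: letter_order_def)
qed

lemma letter_order_linear: "total letter_order" "asym letter_order"
  by (auto simp: letter_order_def total_on_def asym_on_def)

definition flip :: "'i \<times> bool \<Rightarrow> 'i \<times> bool" where
  "flip l = (fst l, \<not> snd l)"

lemma flip_simps [simp]: "flip (flip l) = l" "fst (flip l) = fst l" "snd (flip l) \<longleftrightarrow> \<not> snd l" "flip (i, s) = (i, \<not> s)"
  by (auto simp: flip_def)

lemma reduced_flip: "reduced w \<longleftrightarrow> successively (\<lambda>a b. b \<noteq> flip a) w"
  unfolding reduced_def flip_def by (rule arg_cong2[of _ _ w w successively]) (auto simp: fun_eq_iff prod_eq_iff)

lemma reduced_Nil [simp]: "reduced []"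
  by (simp add: reduced_def)

lemma reduced_Cons: "reduced (l # w) \<longleftrightarrow> reduced w \<and> (w = [] \<or> hd w \<noteq> flip l)"
  by (auto simp: reduced_flip successively_Cons)

lemma reduced_snoc: "reduced (w @ [l]) \<longleftrightarrow> reduced w \<and> (w = [] \<or> last w \<noteq> flip l)"
  by (auto simp: reduced_flip successively_append_iff)

lemma reduced_rev: "reduced (rev w) \<longleftrightarrow> reduced w"
proof -
  have "(\<lambda>a b. b \<noteq> flip a) = (\<lambda>a b :: 'a \<times> bool. a \<noteq> flip b)"
    by (auto simp: fun_eq_iff)
  then show ?thesis by (simp only: reduced_flip successively_rev)
qed

lemma reduced_constant_sign: "(\<And>l. l \<in> set w \<Longrightarrow> snd l = s) \<Longrightarrow> reduced w"
  unfolding reduced_def by (induction w rule: induct_list012) auto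

lemma reduced_map:
  assumes "inj_on h (fst ` set w)"
  shows "reduced (map (map_prod h id) w) \<longleftrightarrow> reduced w"
  unfolding reduced_def successively_map
  by (rule successively_cong) (use assms in \<open>auto dest: inj_onD\<close>)

text \<open>Left multiplication by one letter in the free group, on reduced words.  The lists that it acts on
are words read from the most recent letter backwards.\<close>

fun push :: "'l \<times> bool \<Rightarrow> ('l \<times> bool) list \<Rightarrow> ('l \<times> bool) list" where
  "push a [] = [a]"
| "push a (b # W) = (if b = flip a then W else a # b # W)"

lemma reduced_push: "reduced W \<Longrightarrow> reduced (push a W)"
  by (cases W) (auto simp: reduced_Cons)

lemma reduced_fold_push: "reduced W \<Longrightarrow> reduced (fold push L W)"
  by (induction L arbitrary: W) (auto simp: reduced_push)

text \<open>Prepending a letter is invertible.  This is what turns reduced words into a space on which a group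
can act, and it fails on words that are not reduced.\<close>

lemma push_flip: "reduced W \<Longrightarrow> push (flip a) (push a W) = W"
proof (induction W)
  case (Cons b W)
  then show ?case by (cases W) (auto simp: reduced_Cons)
qed simp

lemma fold_push_reduced: "reduced (rev W @ L) \<Longrightarrow> fold push L W = rev L @ W"
proof (induction L arbitrary: W)
  case (Cons a L)
  then have "reduced (rev (a # W))"
    by (simp add: reduced_flip successively_append_iff)
  then have "push a W = a # W"
    unfolding reduced_rev by (cases W) (auto simp: reduced_Cons)
  then show ?case using Cons by simp
qed simp

section \<open>Actions of a free group and the Schreier basis of a stabilizer\<close>

text \<open>Path classes are composed from left to right, so the monodromy is an action from the right:
\<open>\<tau> (g \<otimes> h)\<close> applies \<open>\<tau> g\<close> first.\<close>

locale right_action = group G for G (structure) +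
  fixes P :: "'p set" and \<tau> :: "'a \<Rightarrow> 'p \<Rightarrow> 'p"
  assumes act_closed: "g \<in> carrier G \<Longrightarrow> p \<in> P \<Longrightarrow> \<tau> g p \<in> P"
    and act_one: "p \<in> P \<Longrightarrow> \<tau> \<one> p = p"
    and act_mult: "g \<in> carrier G \<Longrightarrow> h \<in> carrier G \<Longrightarrow> p \<in> P \<Longrightarrow> \<tau> (g \<otimes> h) p = \<tau> h (\<tau> g p)"
begin

lemma act_inv: "g \<in> carrier G \<Longrightarrow> p \<in> P \<Longrightarrow> \<tau> (inv g) (\<tau> g p) = p"
  and act_inv': "g \<in> carrier G \<Longrightarrow> p \<in> P \<Longrightarrow> \<tau> g (\<tau> (inv g) p) = p"
  using act_mult[of g "inv g" p] act_mult[of "inv g" g p] act_one by auto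

lemma act_pow:
  assumes "g \<in> carrier G" "p \<in> P"
  shows "\<tau> (g [^] (m::nat)) p = ((\<tau> g) ^^ m) p" "((\<tau> g) ^^ m) p \<in> P"
  by (induction m) (use assms act_one act_mult act_closed in auto)

lemma subgroup_stabilizer:
  assumes "p \<in> P"
  shows "subgroup {g \<in> carrier G. \<tau> g p = p} G"
proof (rule subgroupI)
  show "{g \<in> carrier G. \<tau> g p = p} \<noteq> {}" using act_one assms by auto
  fix a assume "a \<in> {g \<in> carrier G. \<tau> g p = p}"
  then show "inv a \<in> {g \<in> carrier G. \<tau> g p = p}" using act_inv[of a p] assms by auto
qed (use act_mult assms in auto)

end

locale free_transitive_action = right_action G P \<tau> for G (structure) and P :: "'p set" and \<tau> +
  fixes I :: "nat set" and \<gamma> :: "nat \<Rightarrow> 'a" and pt :: 'p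
  assumes free: "free_basis G I \<gamma>"
    and base: "pt \<in> P"
    and transitive: "p \<in> P \<Longrightarrow> \<exists>g\<in>carrier G. \<tau> g pt = p"
begin

definition letter_value :: "nat \<times> bool \<Rightarrow> 'a" where
  "letter_value l = (if snd l then \<gamma> (fst l) else inv (\<gamma> (fst l)))"

abbreviation "wv \<equiv> word_value G \<gamma>"
abbreviation "red \<equiv> reduced_word G I \<gamma>"
abbreviation "H \<equiv> {g \<in> carrier G. \<tau> g pt = pt}"

lemma gen_closed: "i \<in> I \<Longrightarrow> \<gamma> i \<in> carrier G"
  using free by (auto simp: free_basis_def)

lemma letter_value_closed: "fst l \<in> I \<Longrightarrow> letter_value l \<in> carrier G"
  by (simp add: letter_value_def gen_closed)

lemma letter_value_flip: "fst l \<in> I \<Longrightarrow> letter_value (flip l) = inv (letter_value l)"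
  by (simp add: letter_value_def gen_closed)

lemma wv_simps: "wv [] = \<one>" "wv (l # w) = letter_value l \<otimes> wv w"
  by (auto simp: word_value_def letter_value_def case_prod_beta)

lemma wv_closed: "fst ` set w \<subseteq> I \<Longrightarrow> wv w \<in> carrier G"
  by (induction w) (auto simp: wv_simps letter_value_closed)

lemma wv_append:
  "fst ` set w \<subseteq> I \<Longrightarrow> fst ` set w' \<subseteq> I \<Longrightarrow> wv (w @ w') = wv w \<otimes> wv w'"
  by (induction w) (auto simp: wv_simps letter_value_closed wv_closed m_assoc)

lemma red_spec: "x \<in> carrier G \<Longrightarrow> is_reduced_word G I \<gamma> x (red x)"
  unfolding reduced_word_def using free by (rule_tac theI') (simp add: free_basis_def)

lemma red:
  assumes "x \<in> carrier G"
  shows "reduced (red x)" "fst ` set (red x) \<subseteq> I" "wv (red x) = x"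
  using red_spec[OF assms] by (auto simp: is_reduced_word_def)

lemma red_wv:
  assumes "reduced w" "fst ` set w \<subseteq> I"
  shows "red (wv w) = w"
proof -
  have "\<exists>!w'. is_reduced_word G I \<gamma> (wv w) w'"
    using free wv_closed[OF assms(2)] by (simp add: free_basis_def)
  moreover have "is_reduced_word G I \<gamma> (wv w) w" using assms by (simp add: is_reduced_word_def)
  moreover have "is_reduced_word G I \<gamma> (wv w) (red (wv w))" by (rule red_spec[OF wv_closed[OF assms(2)]])
  ultimately show ?thesis by (elim ex1E) blast
qed

lemma red_inj: "inj_on red (carrier G)"
  by (rule inj_on_inverseI[of _ wv]) (rule red(3))

text \<open>Right multiplication by a letter either appends it or cancels the last one.  Through this dichotomy,
the freeness of \<open>G\<close> enters both the prefix property of representatives and \<open>run_red\<close>.\<close>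

lemma red_mult_letter:
  assumes x: "x \<in> carrier G" and l: "fst l \<in> I"
  shows "(\<exists>w. red x = w @ [flip l] \<and> red (x \<otimes> letter_value l) = w) \<or> red (x \<otimes> letter_value l) = red x @ [l]"
proof (cases "red x \<noteq> [] \<and> last (red x) = flip l")
  case True
  define w where "w = butlast (red x)"
  have w: "red x = w @ [flip l]" using True append_butlast_last_id[of "red x"] by (simp add: w_def)
  have r: "reduced w" "fst ` set w \<subseteq> I"
    using red[OF x] unfolding w by (auto simp: reduced_snoc)
  have "x = wv (w @ [flip l])" using red(3)[OF x] w by simp
  also have "\<dots> = wv w \<otimes> inv (letter_value l)"
    using r l by (subst wv_append) (auto simp: wv_simps letter_value_flip letter_value_closed)
  finally have "x \<otimes> letter_value l = wv w"
    using wv_closed[OF r(2)] letter_value_closed[OF l] by (simp add: m_assoc)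
  then show ?thesis using red_wv[OF r] w by simp
next
  case False
  have "reduced (red x @ [l])" "fst ` set (red x @ [l]) \<subseteq> I"
    using False red[OF x] l by (auto simp: reduced_snoc)
  moreover have "wv (red x @ [l]) = x \<otimes> letter_value l"
    using red[OF x] l by (simp add: wv_append wv_simps letter_value_closed)
  ultimately show ?thesis using red_wv[of "red x @ [l]"] by simp
qed

definition rep :: "'p \<Rightarrow> 'a" where
  "rep p = (THE m. m \<in> carrier G \<and> \<tau> m pt = p \<and>
     (\<forall>y\<in>carrier G. \<tau> y pt = p \<longrightarrow> y \<noteq> m \<longrightarrow> elem_less G I \<gamma> m y))"

lemma rep:
  assumes p: "p \<in> P"
  shows "rep p \<in> carrier G" "\<tau> (rep p) pt = p"
    "\<And>y. y \<in> carrier G \<Longrightarrow> \<tau> y pt = p \<Longrightarrow> y \<noteq> rep p \<Longrightarrow> (red (rep p), red y) \<in> lenlex letter_order"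
proof -
  let ?Q = "{m \<in> carrier G. \<tau> m pt = p}"
  let ?R = "\<lambda>m. m \<in> carrier G \<and> \<tau> m pt = p \<and>
     (\<forall>y\<in>carrier G. \<tau> y pt = p \<longrightarrow> y \<noteq> m \<longrightarrow> elem_less G I \<gamma> m y)"
  obtain g where "g \<in> ?Q" using transitive[OF p] by auto
  then have "red g \<in> red ` ?Q" by blast
  then obtain w where w: "w \<in> red ` ?Q" "\<And>v. (v, w) \<in> lenlex letter_order \<Longrightarrow> v \<notin> red ` ?Q"
    using wf_lenlex[OF wf_letter_order] by (meson wfE_min)
  then obtain m where m: "m \<in> ?Q" "w = red m" by auto
  have "?R m"
    using m w(2) red_inj total_lenlex[OF letter_order_linear(1)]
    unfolding elem_less_def total_on_def inj_on_def by blast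
  moreover have "m' = m" if "?R m'" for m'
  proof (rule ccontr)
    assume "m' \<noteq> m"
    then have "(red m, red m') \<in> lenlex letter_order" "(red m', red m) \<in> lenlex letter_order"
      using that calculation by (auto simp: elem_less_def)
    then show False
      using asym_lenlex[OF letter_order_linear(2)] unfolding asym_on_def by blast
  qed
  ultimately have "?R (rep p)"
    unfolding rep_def by (rule theI)
  then show "rep p \<in> carrier G" "\<tau> (rep p) pt = p"
    "\<And>y. y \<in> carrier G \<Longrightarrow> \<tau> y pt = p \<Longrightarrow> y \<noteq> rep p \<Longrightarrow> (red (rep p), red y) \<in> lenlex letter_order"
    by (auto simp: elem_less_def)
qed

text \<open>Right cosets of the stabilizer correspond to points, so all Schreier data can be indexed by points.\<close>

lemma coset_eq:
  assumes x: "x \<in> carrier G"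
  shows "H #> x = {y \<in> carrier G. \<tau> y pt = \<tau> x pt}"
proof (intro equalityI subsetI)
  fix y assume "y \<in> {y \<in> carrier G. \<tau> y pt = \<tau> x pt}"
  then have "y \<otimes> inv x \<in> H" "y = y \<otimes> inv x \<otimes> x"
    using x base act_mult act_inv by (auto simp: m_assoc)
  then show "y \<in> H #> x" unfolding r_coset_def by blast
qed (use x base act_mult in \<open>auto simp: r_coset_def\<close>)

lemma coset_min_eq_rep: "x \<in> carrier G \<Longrightarrow> coset_min G I \<gamma> H x = rep (\<tau> x pt)"
  unfolding coset_min_def rep_def coset_eq by (rule arg_cong[of _ _ The]) auto

lemma transversal_eq: "schreier_transversal G I \<gamma> H = rep ` P"
  unfolding schreier_transversal_def
  using coset_min_eq_rep transitive act_closed base by (auto simp: image_iff)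

text \<open>If a shorter or lexicographically earlier \<open>y\<close> reached the same point as the prefix \<open>w\<close>, then \<open>y\<close>
followed by \<open>l\<close> would beat \<open>rep p\<close>: appending a letter preserves the shortlex order, and
cancellation only shortens the word.\<close>

lemma rep_prefix_closed:
  assumes p: "p \<in> P" and wl: "red (rep p) = w @ [l]"
  defines "q \<equiv> \<tau> (wv w) pt"
  shows "q \<in> P" "red (rep q) = w" "fst l \<in> I" "rep p = rep q \<otimes> letter_value l" "\<tau> (letter_value l) q = p"
proof -
  have w: "reduced w" "fst ` set w \<subseteq> I" and l: "fst l \<in> I"
    using red[OF rep(1)[OF p]] unfolding wl by (auto simp: reduced_snoc)
  show "fst l \<in> I" by fact
  show q: "q \<in> P" unfolding q_def using act_closed base wv_closed[OF w(2)] by blast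
  have rp: "rep p = wv w \<otimes> letter_value l"
    using red(3)[OF rep(1)[OF p]] w l unfolding wl by (simp add: wv_append wv_simps letter_value_closed)
  show lq: "\<tau> (letter_value l) q = p"
    using rep(2)[OF p] act_mult base wv_closed[OF w(2)] letter_value_closed[OF l] unfolding q_def rp by simp
  have eq: "rep q = wv w"
  proof (rule ccontr)
    assume "rep q \<noteq> wv w"
    then have less: "(red (rep q), w) \<in> lenlex letter_order"
      using rep(3)[OF q, of "wv w"] wv_closed[OF w(2)] red_wv[OF w] q_def by auto
    \<comment> \<open>the competitor for the point \<open>p\<close> built from the smaller element\<close>
    let ?y = "rep q \<otimes> letter_value l"
    have y: "?y \<in> carrier G" "\<tau> ?y pt = p"
      using rep[OF q] act_mult base letter_value_closed[OF l] lq by auto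
    have "(red ?y, w @ [l]) \<in> lenlex letter_order"
    proof (cases "red ?y = red (rep q) @ [l]")
      case True
      then show ?thesis using lenlex_append1[OF less, of "[l]" "[l]"] by simp
    next
      case False
      then obtain v where v: "red (rep q) = v @ [flip l]" "red ?y = v"
        using red_mult_letter[OF rep(1)[OF q] l] by blast
      then have "length (red ?y) < length (w @ [l])"
        using lenlex_length[OF less] by simp
      then show ?thesis by (simp add: lenlex_conv)
    qed
    moreover have "?y = rep p \<or> (w @ [l], red ?y) \<in> lenlex letter_order"
      using rep(3)[OF p y] wl by auto
    moreover have "asym (lenlex letter_order)" by (rule asym_lenlex[OF letter_order_linear(2)])
    ultimately show False using wl unfolding asym_on_def by fastforce
  qed
  show "red (rep q) = w" using eq red_wv[OF w] by simp
  show "rep p = rep q \<otimes> letter_value l" using eq rp by simp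
qed

text \<open>The edge from \<open>p\<close> labelled \<open>i\<close> is the pair \<open>(p, i)\<close>; its value is the Schreier generator.\<close>

definition edge :: "'p \<times> nat \<Rightarrow> 'a" where
  "edge = (\<lambda>(p, i). rep p \<otimes> \<gamma> i \<otimes> inv (rep (\<tau> (\<gamma> i) p)))"

definition proper_edges :: "('p \<times> nat) set" where
  "proper_edges = {(p, i). p \<in> P \<and> i \<in> I \<and> edge (p, i) \<noteq> \<one>}"

text \<open>The edge crossed when a letter is read at \<open>p\<close>.  An inverse letter runs backwards along the edge that
ends at \<open>p\<close>, so the edge is named by its start, which lies one step further.\<close>

definition label :: "'p \<Rightarrow> nat \<times> bool \<Rightarrow> 'p \<times> nat" where
  "label p l = (if snd l then p else \<tau> (inv (\<gamma> (fst l))) p, fst l)"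

fun trace :: "'p \<Rightarrow> (nat \<times> bool) list \<Rightarrow> (('p \<times> nat) \<times> bool) list" where
  "trace p [] = []"
| "trace p (l # w) = (if label p l \<in> proper_edges then [(label p l, snd l)] else []) @ trace (\<tau> (letter_value l) p) w"

lemma edge_closed: "p \<in> P \<Longrightarrow> i \<in> I \<Longrightarrow> edge (p, i) \<in> carrier G"
  by (simp add: edge_def rep gen_closed act_closed)

lemma edge_fixes: "p \<in> P \<Longrightarrow> i \<in> I \<Longrightarrow> \<tau> (edge (p, i)) pt = pt"
proof -
  assume a: "p \<in> P" "i \<in> I"
  let ?q = "\<tau> (\<gamma> i) p"
  have q: "?q \<in> P" using a act_closed gen_closed by blast
  have "\<tau> (inv (rep ?q)) ?q = pt" using act_inv[OF rep(1)[OF q] base] rep(2)[OF q] by simp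
  then show ?thesis using a q rep gen_closed base by (simp add: edge_def act_mult act_closed)
qed

lemma schreier_basis_eq: "schreier_basis G I \<gamma> H = edge ` proper_edges"
proof -
  have "schreier_gen G I \<gamma> H (rep p) (\<gamma> i) = edge (p, i)" if "p \<in> P" "i \<in> I" for p i
    using that rep[OF that(1)] gen_closed base
    by (simp add: schreier_gen_def coset_min_eq_rep edge_def act_mult)
  then have "(\<lambda>(p, i). schreier_gen G I \<gamma> H (rep p) (\<gamma> i)) ` (P \<times> I) = edge ` (P \<times> I)"
    by (intro image_cong) auto
  moreover have "{schreier_gen G I \<gamma> H x (\<gamma> i) | x i. x \<in> rep ` P \<and> i \<in> I} =
      (\<lambda>(p, i). schreier_gen G I \<gamma> H (rep p) (\<gamma> i)) ` (P \<times> I)"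
    by (rule equalityI; rule subsetI; force)
  moreover have "edge ` proper_edges = edge ` (P \<times> I) - {\<one>}" unfolding proper_edges_def by auto
  ultimately show ?thesis
    unfolding schreier_basis_def transversal_eq by (simp only:)
qed

lemma trace_append:
  assumes "p \<in> P" "fst ` set w \<subseteq> I" "fst ` set w' \<subseteq> I"
  shows "trace p (w @ w') = trace p w @ trace (\<tau> (wv w) p) w'"
  using assms
proof (induction w arbitrary: p)
  case (Cons l w)
  then have "\<tau> (letter_value l) p \<in> P" using act_closed letter_value_closed by simp
  then show ?case using Cons act_mult wv_closed[of w] letter_value_closed[of l] by (simp add: wv_simps)
qed (simp add: wv_simps act_one)

lemma trace_labels: "fst ` set (trace p w) \<subseteq> proper_edges"
  by (induction w arbitrary: p) auto

lemma trace_sign: "(\<And>l. l \<in> set w \<Longrightarrow> snd l = s) \<Longrightarrow> a \<in> set (trace p w) \<Longrightarrow> snd a = s"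
  by (induction w arbitrary: p) (auto split: if_splits)

lemma label_flip: "p \<in> P \<Longrightarrow> fst l \<in> I \<Longrightarrow> label (\<tau> (letter_value l) p) (flip l) = label p l"
  by (cases "snd l") (auto simp: label_def letter_value_def act_inv gen_closed)

lemma run_cancel:
  assumes "p \<in> P" "fst l \<in> I" "reduced W"
  shows "fold push (trace p [l, flip l]) W = W"
  using assms push_flip[OF assms(3), of "(label p l, snd l)"] by (simp add: label_flip)

text \<open>The effect of a word on stacks of edges depends only on the value of the word in \<open>G\<close>, because a
cancelling pair of letters crosses the same edge back and forth.  So \<open>G\<close> itself acts.\<close>

lemma run_red:
  assumes p: "p \<in> P" and W: "reduced W" and w: "fst ` set w \<subseteq> I"
  shows "fold push (trace p (red (wv w))) W = fold push (trace p w) W"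
  using w
proof (induction w rule: rev_induct)
  case Nil
  then show ?case using red_wv[of "[]"] by simp
next
  case (snoc l w)
  then have l: "fst l \<in> I" and w: "fst ` set w \<subseteq> I" by auto
  let ?x = "wv w"
  have x: "?x \<in> carrier G" using wv_closed w by blast
  let ?p = "\<tau> ?x p"
  have wl: "wv (w @ [l]) = ?x \<otimes> letter_value l" using w l by (simp add: wv_append wv_simps letter_value_closed)
  have R: "fold push (trace p (w @ [l])) W = fold push (trace p (red ?x @ [l])) W"
    using snoc w l p red[OF x] by (simp add: trace_append)
  show ?case
  proof (cases "red (?x \<otimes> letter_value l) = red ?x @ [l]")
    case True
    then show ?thesis using R wl by simp
  next
    case False
    then obtain v where v: "red ?x = v @ [flip l]" "red (?x \<otimes> letter_value l) = v"
      using red_mult_letter[OF x l] by blast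
    have vI: "fst ` set v \<subseteq> I" using red(2)[OF x] v(1) by auto
    have "trace p (red ?x @ [l]) = trace p v @ trace (\<tau> (wv v) p) [flip l, flip (flip l)]"
      using vI p l v(1) by (simp add: trace_append del: trace.simps)
    then have "fold push (trace p (red ?x @ [l])) W = fold push (trace p v) W"
      using run_cancel[OF act_closed[OF wv_closed[OF vI] p] _ reduced_fold_push[OF W], of "flip l"] l
      by (simp del: trace.simps)
    then show ?thesis using R wl v by simp
  qed
qed

text \<open>The transport of the stack \<open>W\<close> of crossed edges when \<open>x\<close> is applied at the point \<open>p\<close>.\<close>

definition run :: "'p \<Rightarrow> 'a \<Rightarrow> (('p \<times> nat) \<times> bool) list \<Rightarrow> (('p \<times> nat) \<times> bool) list" where
  "run p x W = fold push (trace p (red x)) W"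

lemma run_wv:
  "p \<in> P \<Longrightarrow> reduced W \<Longrightarrow> fst ` set w \<subseteq> I \<Longrightarrow> run p (wv w) W = fold push (trace p w) W"
  unfolding run_def by (rule run_red)

lemma run_mult:
  assumes p: "p \<in> P" and W: "reduced W" and x: "x \<in> carrier G" and y: "y \<in> carrier G"
  shows "run p (x \<otimes> y) W = run (\<tau> x p) y (run p x W)"
  using run_wv[OF p W, of "red x @ red y"] red[OF x] red[OF y] p
  by (simp add: wv_append trace_append run_def image_Un)

lemma run_one: "run p \<one> W = W"
  using red_wv[of "[]"] by (simp add: run_def wv_simps)

lemma run_inv:
  assumes "p \<in> P" "reduced W" "x \<in> carrier G"
  shows "run (\<tau> x p) (inv x) (run p x W) = W"
  using run_mult[OF assms(1-3), of "inv x"] assms(3) by (simp add: run_one)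

text \<open>By prefix closedness a representative only runs through representatives, and an edge joining a
representative to its extension by one letter has trivial value, in either direction.\<close>

lemma trace_rep: "p \<in> P \<Longrightarrow> trace pt (red (rep p)) = []"
proof (induction "length (red (rep p))" arbitrary: p rule: less_induct)
  case less
  show ?case
  proof (cases "red (rep p)" rule: rev_cases)
    case (snoc w l)
    define q where "q = \<tau> (wv w) pt"
    note q = rep_prefix_closed[OF less(2) snoc, folded q_def]
    have "fst ` set w \<subseteq> I" using red(2)[OF rep(1)[OF less(2)]] snoc by auto
    then have "trace pt (red (rep p)) = trace pt w @ trace q [l]"
      unfolding snoc q_def using q(3) base by (intro trace_append) auto
    moreover have "trace pt w = []" using less(1)[of q] q snoc by auto
    moreover have "label q l \<notin> proper_edges"
    proof (cases "snd l")
      case True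
      then have "edge (label q l) = \<one>"
        using q rep[OF q(1)] rep[OF less(2)] gen_closed by (simp add: label_def edge_def letter_value_def)
      then show ?thesis by (simp add: proper_edges_def case_prod_beta)
    next
      case False
      have p: "\<tau> (inv (\<gamma> (fst l))) q = p" "rep p = rep q \<otimes> inv (\<gamma> (fst l))"
        using q False by (simp_all add: letter_value_def)
      then have "\<tau> (\<gamma> (fst l)) p = q" using act_inv' gen_closed q by metis
      then have "edge (p, fst l) = \<one>"
        using p(2) rep[OF q(1)] gen_closed q(3) by (simp add: edge_def m_assoc)
      then show ?thesis using p(1) False by (simp add: proper_edges_def label_def)
    qed
    ultimately show ?thesis by simp
  qed simp
qed

lemma run_rep: "p \<in> P \<Longrightarrow> run pt (rep p) W = W"
  by (simp add: run_def trace_rep)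

lemma run_inv_rep: "p \<in> P \<Longrightarrow> reduced W \<Longrightarrow> run p (inv (rep p)) W = W"
  using run_inv[OF base, of W "rep p"] by (simp add: run_rep rep)

text \<open>The value of an edge is a path out along the tree, across the edge, and back along the tree; only
the middle step is recorded.\<close>

lemma run_edge:
  assumes a: "a \<in> proper_edges" and W: "reduced W"
  shows "run pt (edge a) W = push (a, True) W"
proof -
  obtain p i where pi: "a = (p, i)" "p \<in> P" "i \<in> I" using a by (auto simp: proper_edges_def)
  let ?q = "\<tau> (\<gamma> i) p"
  have q: "?q \<in> P" using pi act_closed gen_closed by blast
  have "wv [(i, True)] = \<gamma> i" using gen_closed pi by (simp add: wv_simps letter_value_def)
  then have g: "run p (\<gamma> i) W = push (a, True) W"
    using run_wv[OF pi(2) W, of "[(i, True)]"] pi a by (simp add: label_def)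
  have "run pt (edge a) W = run ?q (inv (rep ?q)) (run pt (rep p \<otimes> \<gamma> i) W)"
    using pi q W rep gen_closed base by (simp add: edge_def run_mult act_mult)
  also have "\<dots> = run ?q (inv (rep ?q)) (run p (\<gamma> i) W)"
    using pi W rep gen_closed base by (simp add: run_mult run_rep)
  also have "\<dots> = push (a, True) W"
    unfolding g using run_inv_rep[OF q] reduced_push[OF W] by blast
  finally show ?thesis .
qed

lemma proper_edges_closed: "a \<in> proper_edges \<Longrightarrow> edge a \<in> carrier G" "a \<in> proper_edges \<Longrightarrow> \<tau> (edge a) pt = pt"
  using edge_closed edge_fixes by (auto simp: proper_edges_def)

lemma run_inv_edge:
  assumes a: "a \<in> proper_edges" and W: "reduced W"
  shows "run pt (inv (edge a)) W = push (a, False) W"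
  using run_inv[OF base reduced_push[OF W, of "(a, False)"] proper_edges_closed(1)[OF a]] proper_edges_closed[OF a]
    run_edge[OF a reduced_push[OF W, of "(a, False)"]] push_flip[OF W, of "(a, False)"] by simp

lemma edge_value_closed:
  assumes "fst ` set L \<subseteq> proper_edges"
  shows "word_value G edge L \<in> H"
  using assms
proof (induction L)
  case Nil
  then show ?case using act_one base by (simp add: word_value_def)
next
  case (Cons a L)
  let ?x = "if snd a then edge (fst a) else inv (edge (fst a))"
  have "edge (fst a) \<in> H" using Cons proper_edges_closed by auto
  then have "?x \<in> H" using subgroup.m_inv_closed[OF subgroup_stabilizer[OF base]] by presburger
  moreover have "word_value G edge L \<in> H" using Cons by auto
  ultimately have "?x \<otimes> word_value G edge L \<in> H"
    using subgroup.m_closed[OF subgroup_stabilizer[OF base]] by blast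
  then show ?case by (simp add: word_value_def case_prod_beta)
qed

lemma run_edge_value:
  assumes "fst ` set L \<subseteq> proper_edges" "reduced W"
  shows "run pt (word_value G edge L) W = fold push L W"
  using assms
proof (induction L arbitrary: W)
  case Nil
  then show ?case by (simp add: word_value_def run_one)
next
  case (Cons a L)
  let ?x = "if snd a then edge (fst a) else inv (edge (fst a))"
  have a: "fst a \<in> proper_edges" and L: "fst ` set L \<subseteq> proper_edges" using Cons by auto
  have x: "?x \<in> carrier G" "\<tau> ?x pt = pt"
    using proper_edges_closed[OF a] act_inv[OF proper_edges_closed(1)[OF a] base] by auto
  have v: "word_value G edge L \<in> carrier G" using edge_value_closed[OF L] by blast
  have "run pt (word_value G edge (a # L)) W = run pt (?x \<otimes> word_value G edge L) W"
    by (simp add: word_value_def case_prod_beta)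
  also have "\<dots> = run pt (word_value G edge L) (run pt ?x W)"
    using run_mult[OF base Cons(3) x(1) v] x(2) by metis
  also have "run pt ?x W = push a W"
    using run_edge[OF a Cons(3)] run_inv_edge[OF a Cons(3)] by (cases a) auto
  finally show ?case using Cons(1)[OF L reduced_push[OF Cons(3)]] by simp
qed

text \<open>Acting on the empty stack, a reduced word over the edges leaves itself (reversed), so it is
determined by its value: the Schreier generators generate freely.\<close>

lemma edge_word_unique:
  assumes "reduced L" "fst ` set L \<subseteq> proper_edges" "reduced L'" "fst ` set L' \<subseteq> proper_edges"
    "word_value G edge L = word_value G edge L'"
  shows "L = L'"
proof -
  have "run pt (word_value G edge M) [] = rev M" if "reduced M" "fst ` set M \<subseteq> proper_edges" for M
    using run_edge_value[OF that(2) reduced_Nil] fold_push_reduced[of "[]" M] that(1) by simp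
  from this[OF assms(1,2)] this[OF assms(3,4)] have "rev L = rev L'"
    unfolding assms(5) by (rule trans[OF sym])
  then show ?thesis by simp
qed

lemma inj_edge: "inj_on edge proper_edges"
proof (rule inj_onI)
  fix a a' assume "a \<in> proper_edges" "a' \<in> proper_edges" "edge a = edge a'"
  then have "[(a, True)] = [(a', True)]"
    by (intro edge_word_unique) (auto simp: word_value_def reduced_Cons)
  then show "a = a'" by simp
qed

text \<open>The word is carried over to the index set of edges, on which \<open>edge\<close> is injective, and uniqueness is
applied there.\<close>

lemma reduced_word_schreier:
  assumes L: "reduced L" "fst ` set L \<subseteq> proper_edges"
  shows "reduced_word (G\<lparr>carrier := H\<rparr>) (edge ` proper_edges) (\<lambda>y. y) (word_value G edge L)
    = map (map_prod edge id) L"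
proof -
  have val: "word_value (G\<lparr>carrier := H\<rparr>) (\<lambda>y. y) (map (map_prod edge id) M) = word_value G edge M"
    if "fst ` set M \<subseteq> proper_edges" for M
    using that
  proof (induction M)
    case (Cons a M)
    then have "edge (fst a) \<in> H" using proper_edges_closed by auto
    then have "inv\<^bsub>G\<lparr>carrier := H\<rparr>\<^esub> (edge (fst a)) = inv (edge (fst a))"
      by (rule m_inv_consistent[OF subgroup_stabilizer[OF base]])
    then show ?case using Cons by (simp add: word_value_def case_prod_beta)
  qed (simp add: word_value_def)
  let ?isr = "is_reduced_word (G\<lparr>carrier := H\<rparr>) (edge ` proper_edges) (\<lambda>y. y) (word_value G edge L)"
  have inj: "inj_on edge (fst ` set M)" if "fst ` set M \<subseteq> proper_edges" for M :: "(('p \<times> nat) \<times> bool) list"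
    using inj_edge that by (rule inj_on_subset)
  show ?thesis unfolding reduced_word_def
  proof (rule the_equality)
    show "?isr (map (map_prod edge id) L)"
      using L val[OF L(2)] reduced_map[OF inj[OF L(2)]] by (auto simp: is_reduced_word_def)
    fix w assume w: "?isr w"
    define M where "M = map (map_prod (inv_into proper_edges edge) id) w"
    have wY: "fst ` set w \<subseteq> edge ` proper_edges" using w by (simp add: is_reduced_word_def)
    have M: "fst ` set M \<subseteq> proper_edges"
      using wY unfolding M_def by (auto simp: image_subset_iff intro!: inv_into_into)
    have "map (map_prod edge id) M = w"
      unfolding M_def map_map
    proof (rule map_idI)
      fix a assume "a \<in> set w"
      then have "fst a \<in> edge ` proper_edges" using wY by blast
      then show "(map_prod edge id \<circ> map_prod (inv_into proper_edges edge) id) a = a"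
        by (simp add: prod_eq_iff f_inv_into_f)
    qed
    note wM = this[symmetric]
    have "M = L"
      using w val[OF M] reduced_map[OF inj[OF M]] L M
      by (intro edge_word_unique) (auto simp: is_reduced_word_def wM)
    then show "w = map (map_prod edge id) L" using wM by simp
  qed
qed

text \<open>The Reidemeister--Schreier rewriting: the representatives of consecutive points telescope.\<close>

lemma trace_value:
  assumes "p \<in> P" "fst ` set w \<subseteq> I"
  shows "word_value G edge (trace p w) = rep p \<otimes> wv w \<otimes> inv (rep (\<tau> (wv w) p))"
  using assms
proof (induction w arbitrary: p)
  case Nil
  then show ?case using rep by (simp add: word_value_def act_one)
next
  case (Cons l w)
  have l: "fst l \<in> I" and w: "fst ` set w \<subseteq> I" using Cons by auto
  let ?q = "\<tau> (letter_value l) p"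
  have q: "?q \<in> P" using Cons act_closed letter_value_closed l by blast
  have lP: "label p l \<in> P \<times> I" using Cons(2) l gen_closed act_closed by (auto simp: label_def)
  let ?x = "if snd l then edge (label p l) else inv (edge (label p l))"
  have x: "?x = rep p \<otimes> letter_value l \<otimes> inv (rep ?q)"
  proof (cases "snd l")
    case True
    then show ?thesis by (simp add: label_def edge_def letter_value_def)
  next
    case False
    then show ?thesis
      using Cons(2) l q rep gen_closed act_inv'
      by (simp add: label_def edge_def letter_value_def inv_mult_group m_assoc)
  qed
  have xc: "?x \<in> carrier G" unfolding x using Cons(2) rep q letter_value_closed l by simp
  have T: "word_value G edge (trace ?q w) \<in> carrier G"
    using edge_value_closed[OF trace_labels] by blast
  have "word_value G edge (trace p (l # w)) = ?x \<otimes> word_value G edge (trace ?q w)"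
    using lP T by (auto simp: word_value_def proper_edges_def case_prod_beta)
  also have "\<dots> = rep p \<otimes> letter_value l \<otimes> inv (rep ?q) \<otimes> (rep ?q \<otimes> wv w \<otimes> inv (rep (\<tau> (wv w) ?q)))"
    unfolding x using Cons(1)[OF q w] by simp
  also have "\<dots> = rep p \<otimes> (letter_value l \<otimes> wv w) \<otimes> inv (rep (\<tau> (wv w) ?q))"
    using rep(1)[OF Cons(2)] rep(1)[OF q] rep(1)[OF act_closed[OF wv_closed[OF w] q]] letter_value_closed[OF l] wv_closed[OF w]
    by (simp add: m_assoc inv_solve_left' flip: m_assoc[of "inv (rep ?q)" "rep ?q"])
  also have "\<tau> (wv w) ?q = \<tau> (wv (l # w)) p"
    using act_mult Cons(2) letter_value_closed[OF l] wv_closed[OF w] by (simp add: wv_simps)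
  finally show ?case by (simp add: wv_simps)
qed

text \<open>For a word whose letters all have the same sign no cancellation can occur in the trace.\<close>

lemma reduced_word_conj:
  assumes p: "p \<in> P" and w: "fst ` set w \<subseteq> I" "\<And>l. l \<in> set w \<Longrightarrow> snd l = s"
    and fixed: "\<tau> (wv w) p = p"
  shows "reduced_word (G\<lparr>carrier := H\<rparr>) (edge ` proper_edges) (\<lambda>y. y) (rep p \<otimes> wv w \<otimes> inv (rep p))
    = map (map_prod edge id) (trace p w)"
proof -
  have red: "reduced (trace p w)"
    by (rule reduced_constant_sign) (rule trace_sign[OF w(2)])
  have val: "word_value G edge (trace p w) = rep p \<otimes> wv w \<otimes> inv (rep p)"
    using trace_value[OF p w(1)] unfolding fixed .
  show ?thesis using reduced_word_schreier[OF red trace_labels] unfolding val .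
qed

lemma wv_power:
  assumes "fst ` set w \<subseteq> I"
  shows "wv (concat (replicate m w)) = wv w [^] m"
proof (induction m)
  case (Suc m)
  have "fst ` set (concat (replicate m w)) \<subseteq> I"
    using assms by (auto simp: image_subset_iff)
  then show ?case
    unfolding nat_pow_Suc2[OF wv_closed[OF assms]] using Suc assms by (simp add: wv_append)
qed (simp add: wv_simps)

lemma trace_power:
  assumes "p \<in> P" "fst ` set w \<subseteq> I"
  shows "set (trace p (concat (replicate m w))) = (\<Union>a<m. set (trace (((\<tau> (wv w)) ^^ a) p) w))"
proof (induction m)
  case (Suc m)
  have I: "fst ` set (concat (replicate m w)) \<subseteq> I"
    using assms(2) by (auto simp: image_subset_iff)
  have "concat (replicate (Suc m) w) = concat (replicate m w) @ w"
    by (simp flip: replicate_append_same)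
  then have "trace p (concat (replicate (Suc m) w)) =
      trace p (concat (replicate m w)) @ trace ((\<tau> (wv w) ^^ m) p) w"
    using trace_append[OF assms(1) I assms(2)] wv_power[OF assms(2)]
      act_pow(1)[OF wv_closed[OF assms(2)] assms(1)] by simp
  then show ?case using Suc by (auto simp: lessThan_Suc)
qed simp

text \<open>Reading pairwise different inverse letters, the letter \<open>i\<close> is read once, and the edge crossed then
starts at the point reached after reading it.  That point is the image of \<open>p\<close> under a fixed
permutation, given by the word up to and including \<open>i\<close>.\<close>

lemma trace_distinct_negative:
  assumes "p \<in> P" "set is \<subseteq> I" "distinct is" "(q, i) \<in> proper_edges"
  shows "((q, i), False) \<in> set (trace p (map (\<lambda>i. (i, False)) is)) \<longleftrightarrow>
    i \<in> set is \<and> q = \<tau> (wv (map (\<lambda>i. (i, False)) (takeWhile (\<lambda>j. j \<noteq> i) is @ [i]))) p"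
  using assms
proof (induction "is" arbitrary: p)
  case (Cons j js)
  let ?q = "\<tau> (letter_value (j, False)) p"
  have j: "j \<in> I" "letter_value (j, False) = inv (\<gamma> j)" "\<gamma> j \<in> carrier G"
    using Cons gen_closed by (auto simp: letter_value_def)
  have q: "?q \<in> P" using Cons act_closed j by simp
  show ?case
  proof (cases "i = j")
    case True
    then have "((q, i), False) \<notin> set (trace ?q (map (\<lambda>i. (i, False)) js))"
      using Cons q by (subst Cons(1)) auto
    then show ?thesis using True Cons j by (auto simp: label_def wv_simps)
  next
    case False
    let ?w = "map (\<lambda>i. (i, False)) (takeWhile (\<lambda>j. j \<noteq> i) js @ [i])"
    have wI: "fst ` set ?w \<subseteq> I"
      using Cons(3,5) by (auto simp: proper_edges_def dest: set_takeWhileD)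
    have "\<tau> (wv ((j, False) # ?w)) p = \<tau> (wv ?w) ?q"
      using act_mult[OF _ wv_closed[OF wI] Cons(2)] j by (simp add: wv_simps)
    then show ?thesis using False Cons(1)[OF q] Cons(3-) by (auto simp: label_def)
  qed
qed simp

lemma wv_rev_flip:
  assumes "fst ` set w \<subseteq> I"
  shows "wv (rev (map flip w)) = inv (wv w)"
  using assms
proof (induction w)
  case (Cons l w)
  then have "fst ` set (rev (map flip w)) \<subseteq> I" by (auto simp: image_subset_iff)
  then show ?case
    using Cons by (simp add: wv_append wv_simps letter_value_flip letter_value_closed wv_closed inv_mult_group)
qed (simp add: wv_simps)

lemma letter_in_reduced_word:
  assumes "p \<in> P" "fst ` set v \<subseteq> I" "\<And>l. l \<in> set v \<Longrightarrow> snd l = s"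
    and fixed: "(\<tau> (wv v) ^^ m) p = p" and a: "a \<in> proper_edges"
  shows "(edge a, s') \<in> set (reduced_word (G\<lparr>carrier := H\<rparr>) (edge ` proper_edges) (\<lambda>y. y)
      (rep p \<otimes> wv v [^] m \<otimes> inv (rep p)))
    \<longleftrightarrow> (\<exists>c<m. (a, s') \<in> set (trace ((\<tau> (wv v) ^^ c) p) v))"
proof -
  let ?w = "concat (replicate m v)"
  have w: "fst ` set ?w \<subseteq> I" "\<And>l. l \<in> set ?w \<Longrightarrow> snd l = s"
    using assms(2,3) by (auto simp: image_subset_iff)
  have pow: "wv ?w = wv v [^] m" using wv_power[OF assms(2)] .
  have "\<tau> (wv ?w) p = p"
    using act_pow(1)[OF wv_closed[OF assms(2)] assms(1)] fixed by (simp add: pow)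
  from reduced_word_conj[OF assms(1) w this]
  have "reduced_word (G\<lparr>carrier := H\<rparr>) (edge ` proper_edges) (\<lambda>y. y) (rep p \<otimes> wv v [^] m \<otimes> inv (rep p))
      = map (map_prod edge id) (trace p ?w)"
    unfolding pow .
  moreover have "(edge a, s') \<in> map_prod edge id ` set (trace p ?w) \<longleftrightarrow> (a, s') \<in> set (trace p ?w)"
  proof
    assume "(edge a, s') \<in> map_prod edge id ` set (trace p ?w)"
    then obtain a' where a': "(a', s') \<in> set (trace p ?w)" "edge a' = edge a" by auto
    then have "a' \<in> proper_edges" using trace_labels by force
    then show "(a, s') \<in> set (trace p ?w)" using a' inj_onD[OF inj_edge a'(2)] a by blast
  qed force
  ultimately show ?thesis
    using trace_power[OF assms(1,2)] by auto
qed

lemma positive_letter_iff: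
  assumes i: "i \<in> I" and p: "p \<in> P" and fixed: "(\<tau> (\<gamma> i) ^^ m) p = p" and D: "(q, i') \<in> proper_edges"
  shows "(edge (q, i'), True) \<in> set (reduced_word (G\<lparr>carrier := H\<rparr>) (edge ` proper_edges) (\<lambda>y. y)
      (rep p \<otimes> \<gamma> i [^] m \<otimes> inv (rep p)))
    \<longleftrightarrow> i' = i \<and> q \<in> (\<lambda>c. (\<tau> (\<gamma> i) ^^ c) p) ` {..<m}"
proof -
  have v: "wv [(i, True)] = \<gamma> i" using gen_closed[OF i] by (simp add: wv_simps letter_value_def)
  have "(edge (q, i'), True) \<in> set (reduced_word (G\<lparr>carrier := H\<rparr>) (edge ` proper_edges) (\<lambda>y. y)
      (rep p \<otimes> \<gamma> i [^] m \<otimes> inv (rep p)))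
    \<longleftrightarrow> (\<exists>c<m. ((q, i'), True) \<in> set (trace ((\<tau> (\<gamma> i) ^^ c) p) [(i, True)]))"
    using letter_in_reduced_word[OF p, of "[(i, True)]" True m "(q, i')" True] i fixed D
    unfolding v by simp
  also have "\<dots> \<longleftrightarrow> i' = i \<and> q \<in> (\<lambda>c. (\<tau> (\<gamma> i) ^^ c) p) ` {..<m}"
    using D by (auto simp: label_def)
  finally show ?thesis .
qed

text \<open>Within one reading of \<open>c\<close>, the edge labelled \<open>i\<close> at \<open>q\<close> is crossed from exactly one starting point,
and \<open>\<tau> h\<close> recovers that point from \<open>q\<close>; so the edge occurs when this point is among those visited
by the powers of \<open>c\<close>.\<close>

lemma negative_letter_iff:
  assumes ds: "distinct is" "set is = I" and p: "p \<in> P" and D: "(q, i) \<in> proper_edges"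
  defines "c \<equiv> wv (map (\<lambda>i. (i, False)) is)"
    and "h \<equiv> inv (wv (map (\<lambda>i. (i, False)) (takeWhile (\<lambda>j. j \<noteq> i) is @ [i])))"
  assumes fixed: "(\<tau> c ^^ m) p = p"
  shows "(edge (q, i), False) \<in> set (reduced_word (G\<lparr>carrier := H\<rparr>) (edge ` proper_edges) (\<lambda>y. y)
      (rep p \<otimes> c [^] m \<otimes> inv (rep p)))
    \<longleftrightarrow> \<tau> h q \<in> (\<lambda>a. (\<tau> c ^^ a) p) ` {..<m}"
proof -
  let ?v = "map (\<lambda>i. (i, False)) is"
  let ?g = "wv (map (\<lambda>i. (i, False)) (takeWhile (\<lambda>j. j \<noteq> i) is @ [i]))"
  have i: "i \<in> I" "q \<in> P" using D by (auto simp: proper_edges_def)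
  have g: "?g \<in> carrier G"
    by (rule wv_closed) (use i ds in \<open>auto dest: set_takeWhileD\<close>)
  have c: "c \<in> carrier G" unfolding c_def by (rule wv_closed) (use ds in auto)
  have "(edge (q, i), False) \<in> set (reduced_word (G\<lparr>carrier := H\<rparr>) (edge ` proper_edges) (\<lambda>y. y)
      (rep p \<otimes> c [^] m \<otimes> inv (rep p)))
    \<longleftrightarrow> (\<exists>a<m. ((q, i), False) \<in> set (trace ((\<tau> c ^^ a) p) ?v))"
    unfolding c_def
    by (rule letter_in_reduced_word[OF p, where s = False])
       (use ds fixed D in \<open>auto simp: c_def\<close>)
  also have "\<dots> \<longleftrightarrow> (\<exists>a<m. q = \<tau> ?g ((\<tau> c ^^ a) p))"
    using trace_distinct_negative[OF act_pow(2)[OF c p] _ ds(1) D] i ds(2) by simp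
  also have "\<dots> \<longleftrightarrow> (\<exists>a<m. \<tau> h q = (\<tau> c ^^ a) p)"
  proof -
    have "q = \<tau> ?g x \<longleftrightarrow> \<tau> h q = x" if "x \<in> P" for x
      unfolding h_def using act_inv[OF g that] act_inv'[OF g i(2)] by auto
    then show ?thesis using act_pow(2)[OF c p] by blast
  qed
  finally show ?thesis by auto
qed

end

context free_transitive_action
begin

lemma foldr_gen: "foldr (\<lambda>i x. \<gamma> i \<otimes> x) is \<one> = wv (map (\<lambda>i. (i, True)) is)"
  by (induction "is") (auto simp: wv_simps letter_value_def)

lemma foldr_inv_gen: "foldr (\<lambda>i x. inv (\<gamma> i) \<otimes> x) is \<one> = wv (map (\<lambda>i. (i, False)) is)"
  by (induction "is") (auto simp: wv_simps letter_value_def)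

text \<open>The relation \<open>\<gamma>\<^sub>1 \<cdots> \<gamma>\<^sub>r = 1\<close> turns \<open>\<gamma>\<^sub>r\<close> into a word with negative letters only.\<close>

lemma last_generator:
  assumes I: "I = {1..<r}" and r: "1 \<le> r" "\<gamma> r \<in> carrier G"
    and rel: "foldr (\<lambda>i x. \<gamma> i \<otimes> x) [1..<Suc r] \<one> = \<one>"
  shows "\<gamma> r = wv (map (\<lambda>i. (i, False)) (rev [1..<r]))"
proof -
  let ?w = "map (\<lambda>i. (i, True)) [1..<r]"
  have w: "fst ` set ?w \<subseteq> I" using I by auto
  have snoc: "foldr (\<lambda>i x. \<gamma> i \<otimes> x) js y = foldr (\<lambda>i x. \<gamma> i \<otimes> x) js \<one> \<otimes> y"
    if "set js \<subseteq> I" "y \<in> carrier G" for js y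
    using that
  proof (induction js)
    case (Cons j js)
    have "foldr (\<lambda>i x. \<gamma> i \<otimes> x) js \<one> \<in> carrier G"
      unfolding foldr_gen using Cons by (intro wv_closed) auto
    then show ?case using Cons gen_closed[of j] by (simp add: m_assoc)
  qed simp
  have "\<one> = foldr (\<lambda>i x. \<gamma> i \<otimes> x) [1..<r] (\<gamma> r)"
    using rel r by simp
  also have "\<dots> = wv ?w \<otimes> \<gamma> r"
    using snoc[of "[1..<r]" "\<gamma> r"] r(2) I unfolding foldr_gen by simp
  finally have "\<one> = wv ?w \<otimes> \<gamma> r" .
  then have "inv (\<gamma> r) = wv ?w"
    by (intro inv_equality[OF sym]) (use wv_closed[OF w] r(2) in auto)
  then have "\<gamma> r = inv (wv ?w)" using inv_inv[OF r(2)] by metis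
  also have "\<dots> = wv (rev (map flip ?w))" using wv_rev_flip[OF w] by simp
  finally show ?thesis by (simp add: rev_map comp_def)
qed

lemma in_stabilizer_conj:
  assumes "p \<in> P" "d \<in> carrier G" "\<tau> d pt = p" "g \<in> carrier G" "\<tau> g p = p"
  shows "d \<otimes> g \<otimes> inv d \<in> H"
  using assms act_mult act_inv base by auto

text \<open>If \<open>d'\<close> reaches a point of the same cycle as \<open>d\<close>, then \<open>d' = h d g\<^sup>a\<close> with \<open>h\<close> in the stabilizer, and
\<open>g\<^sup>a\<close> commutes with \<open>g\<^sup>m\<close>.\<close>

lemma conj_independent_of_path:
  assumes d: "d \<in> carrier G" "d' \<in> carrier G" and g: "g \<in> carrier G"
    and eq: "\<tau> d' pt = \<tau> (d \<otimes> g [^] (a::nat)) pt"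
  shows "\<exists>h\<in>H. d' \<otimes> g [^] (m::nat) \<otimes> inv d' = h \<otimes> (d \<otimes> g [^] m \<otimes> inv d) \<otimes> inv h"
proof
  let ?h = "d' \<otimes> inv (d \<otimes> g [^] a)"
  have c: "d \<otimes> g [^] a \<in> carrier G" using d g by simp
  have dh: "d' = ?h \<otimes> (d \<otimes> g [^] a)" "?h \<in> carrier G" using d c by (auto simp: m_assoc)
  show "?h \<in> H" using eq d c base act_mult act_inv by auto
  have "g [^] a \<otimes> g [^] m = g [^] m \<otimes> g [^] a"
    using g by (simp add: nat_pow_mult add.commute)
  then have com: "g [^] a \<otimes> g [^] m \<otimes> inv (g [^] a) = g [^] m"
    using g by (simp add: m_assoc)
  have "d' \<otimes> g [^] m \<otimes> inv d'
      = ?h \<otimes> (d \<otimes> (g [^] a \<otimes> g [^] m \<otimes> inv (g [^] a)) \<otimes> inv d) \<otimes> inv ?h"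
  proof -
    have "x \<otimes> y \<otimes> inv x = k \<otimes> (d \<otimes> (z \<otimes> y \<otimes> inv z) \<otimes> inv d) \<otimes> inv k"
      if "x = k \<otimes> (d \<otimes> z)" "k \<in> carrier G" "y \<in> carrier G" "z \<in> carrier G" for x y z k
      using that d by (simp add: inv_mult_group m_assoc)
    from this[OF dh, of "g [^] m"] show ?thesis using g by simp
  qed
  then show "d' \<otimes> g [^] m \<otimes> inv d' = ?h \<otimes> (d \<otimes> g [^] m \<otimes> inv d) \<otimes> inv ?h"
    unfolding com .
qed

end

section \<open>Cycles of permutations\<close>

text \<open>Disjointness makes every factor but one fix \<open>t\<close>, whatever the order of composition.\<close>

lemma foldr_cycles:
  assumes "distinct js" "disjoint_family_on (\<lambda>j. set (e j)) (set js)" "j \<in> set js" "t \<in> set (e j)"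
  shows "foldr (\<lambda>j p. cycle_of_list (e j) \<circ> p) js id t = cycle_of_list (e j) t"
proof -
  have out: "foldr (\<lambda>j p. cycle_of_list (e j) \<circ> p) js id x = x"
    if "\<And>i. i \<in> set js \<Longrightarrow> x \<notin> set (e i)" for js x
    using that by (induction js) (auto simp: id_outside_supp)
  show ?thesis
    using assms
  proof (induction js)
    case (Cons a js)
    have step: "foldr (\<lambda>j p. cycle_of_list (e j) \<circ> p) (a # js) id t =
        cycle_of_list (e a) (foldr (\<lambda>j p. cycle_of_list (e j) \<circ> p) js id t)"
      by simp
    show ?case
    proof (cases "j = a")
      case True
      then have "foldr (\<lambda>j p. cycle_of_list (e j) \<circ> p) js id t = t"
        using Cons.prems by (intro out) (auto simp: disjoint_family_on_def)
      then show ?thesis unfolding step using True by simp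
    next
      case False
      then have j: "j \<in> set js" using Cons.prems by simp
      have "cycle_of_list (e j) t \<in> set (e j)"
        using cycle_permutes[of "e j"] Cons.prems(4) by (simp add: permutes_in_image)
      then have "cycle_of_list (e j) t \<notin> set (e a)"
        using Cons.prems(2) False j by (auto simp: disjoint_family_on_def)
      have dj: "disjoint_family_on (\<lambda>j. set (e j)) (set js)"
        using Cons.prems(2) by (auto simp: disjoint_family_on_def)
      have "foldr (\<lambda>j p. cycle_of_list (e j) \<circ> p) js id t = cycle_of_list (e j) t"
        by (rule Cons.IH[OF _ dj j Cons.prems(4)]) (use Cons.prems(1) in simp)
      then show ?thesis
        unfolding step using \<open>cycle_of_list (e j) t \<notin> set (e a)\<close> by (simp add: id_outside_supp)
    qed
  qed simp
qed

lemma cycle_orbit: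
  assumes cs: "distinct cs" and t: "t \<in> set cs"
  shows "(\<lambda>a. (cycle_of_list cs ^^ a) t) ` {..<length cs} = set cs"
proof -
  obtain b where b: "b < length cs" "t = cs ! b" using t by (auto simp: in_set_conv_nth)
  have pow: "(cycle_of_list cs ^^ a) t = cs ! ((a + b) mod length cs)" for a
    using arg_cong[OF cyclic_rotation[OF cs, of a], of "\<lambda>xs. xs ! b"] b by (simp add: nth_rotate)
  have "cs ! c \<in> (\<lambda>a. (cycle_of_list cs ^^ a) t) ` {..<length cs}" if c: "c < length cs" for c
  proof -
    define a where "a = (c + (length cs - b)) mod length cs"
    have "(a + b) mod length cs = (c + (length cs - b) + b) mod length cs"
      unfolding a_def by (rule mod_add_left_eq)
    also have "\<dots> = c" using b(1) c by simp
    finally have "(cycle_of_list cs ^^ a) t = cs ! c" by (simp add: pow)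
    moreover have "a < length cs" unfolding a_def by (rule mod_less_divisor) (use c in linarith)
    ultimately show ?thesis by force
  qed
  moreover have "(cycle_of_list cs ^^ a) t \<in> set cs" for a
    unfolding pow by (rule nth_mem, rule mod_less_divisor) (use b(1) in linarith)
  ultimately show ?thesis by (auto simp: in_set_conv_nth)
qed

lemma cycle_decomposition_orbit:
  assumes d: "disjoint_cycle_decomposition n \<sigma> k e" and j: "j \<in> {1..k}" and t: "t \<in> set (e j)"
  shows "(\<lambda>a. (\<sigma> ^^ a) t) ` {..<length (e j)} = set (e j)" "(\<sigma> ^^ length (e j)) t = t"
proof -
  have ej: "distinct (e j)" using d j by (auto simp: disjoint_cycle_decomposition_def)
  have \<sigma>: "\<sigma> x = cycle_of_list (e j) x" if "x \<in> set (e j)" for x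
  proof -
    have "\<sigma> = foldr (\<lambda>j p. cycle_of_list (e j) \<circ> p) [1..<Suc k] id"
      "disjoint_family_on (\<lambda>j. set (e j)) {1..k}"
      using d by (auto simp: disjoint_cycle_decomposition_def)
    moreover have "set [1..<Suc k] = {1..k}" by auto
    ultimately show ?thesis
      using foldr_cycles[of "[1..<Suc k]" e j x] that j by (simp del: upt_Suc)
  qed
  have pow: "(\<sigma> ^^ a) t = (cycle_of_list (e j) ^^ a) t \<and> (\<sigma> ^^ a) t \<in> set (e j)" for a
  proof (induction a)
    case (Suc a)
    have "\<sigma> ((\<sigma> ^^ a) t) = cycle_of_list (e j) ((cycle_of_list (e j) ^^ a) t)"
      using \<sigma>[OF conjunct2[OF Suc]] arg_cong[OF conjunct1[OF Suc], of "cycle_of_list (e j)"]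
      by (rule trans)
    moreover have "cycle_of_list (e j) ((cycle_of_list (e j) ^^ a) t) \<in> set (e j)"
      using Suc by (auto simp: permutes_in_image[OF cycle_permutes])
    ultimately show ?case by simp
  qed (simp add: t)
  then show "(\<lambda>a. (\<sigma> ^^ a) t) ` {..<length (e j)} = set (e j)"
    using cycle_orbit[OF ej t] by simp
  show "(\<sigma> ^^ length (e j)) t = t" using pow cycle_is_id_root[OF ej] by simp
qed

lemma cycle_decomposition_ex1:
  assumes d: "disjoint_cycle_decomposition n \<sigma> k e" and p: "p \<in> {1..n}"
  shows "\<exists>!j. j \<in> {1..k} \<and> p \<in> set (e j)"
proof -
  have "p \<in> (\<Union>j\<in>{1..k}. set (e j))" "disjoint_family_on (\<lambda>j. set (e j)) {1..k}"
    using d p by (auto simp: disjoint_cycle_decomposition_def)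
  then show ?thesis unfolding disjoint_family_on_def by blast
qed

lemma cycle_decomposition_subset:
  "disjoint_cycle_decomposition n \<sigma> k e \<Longrightarrow> j \<in> {1..k} \<Longrightarrow> t \<in> set (e j) \<Longrightarrow> t \<in> {1..n}"
  unfolding disjoint_cycle_decomposition_def by blast

section \<open>Normal closures\<close>

lemma (in group) normal_closure_normal:
  assumes "A \<subseteq> carrier G"
  shows "normal_closure G A \<lhd> G" "A \<subseteq> normal_closure G A"
proof -
  let ?\<N> = "{N. N \<lhd> G \<and> A \<subseteq> N}"
  have "carrier G \<lhd> G" by (simp add: normal_inv_iff subgroup_self)
  then have "?\<N> \<noteq> {}" using assms by blast
  then have "subgroup (\<Inter>?\<N>) G"
    by (intro subgroups_Inter) (auto simp: normal_inv_iff)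
  then show "normal_closure G A \<lhd> G"
    unfolding normal_closure_def by (auto simp: normal_inv_iff)
qed (auto simp: normal_closure_def)

lemma normal_closure_least: "N \<lhd> G \<Longrightarrow> A \<subseteq> N \<Longrightarrow> normal_closure G A \<subseteq> N"
  by (auto simp: normal_closure_def)

text \<open>One inclusion holds for every isomorphism, as the image of a normal subgroup under a surjective
homomorphism is normal; the other one is the same inclusion for the inverse.\<close>

lemma (in group) normal_closure_iso_image:
  assumes K: "group K" and h: "h \<in> iso G K" and A: "A \<subseteq> carrier G"
  shows "h ` normal_closure G A = normal_closure K (h ` A)"
proof
  have incl: "normal_closure K' (g ` S) \<subseteq> g ` normal_closure G' S"
    if "group G'" "group K'" "g \<in> iso G' K'" "S \<subseteq> carrier G'"
    for G' :: "('x, 'y) monoid_scheme" and K' :: "('u, 'v) monoid_scheme" and g S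
  proof (rule normal_closure_least)
    interpret G': group G' by fact
    have "group_hom G' K' g"
      using that by (auto simp: group_hom_def group_hom_axioms_def iso_def)
    moreover have "g ` carrier G' = carrier K'" using that(3) by (auto simp: iso_def bij_betw_def)
    ultimately show "g ` normal_closure G' S \<lhd> K'"
      using normal.surj_hom_normal_subgroup G'.normal_closure_normal(1)[OF that(4)] by blast
    show "g ` S \<subseteq> g ` normal_closure G' S"
      using G'.normal_closure_normal(2)[OF that(4)] by blast
  qed
  show "normal_closure K (h ` A) \<subseteq> h ` normal_closure G A"
    by (rule incl[OF group_axioms K h A])
  let ?h' = "inv_into (carrier G) h"
  have bij: "bij_betw h (carrier G) (carrier K)" using h by (simp add: iso_def)
  then have hA: "h ` A \<subseteq> carrier K" using A by (auto simp: bij_betw_def)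
  have "?h' ` h ` A = A"
    using bij A inv_into_image_cancel[of h "carrier G" A] by (simp add: bij_betw_def)
  then have "normal_closure G A \<subseteq> ?h' ` normal_closure K (h ` A)"
    using incl[OF K group_axioms iso_set_sym[OF h] hA] by simp
  then have "h ` normal_closure G A \<subseteq> h ` ?h' ` normal_closure K (h ` A)" by blast
  moreover have "normal_closure K (h ` A) \<subseteq> h ` carrier G"
    using group.normal_closure_normal(1)[OF K hA] bij
    by (auto simp: bij_betw_def group.normal_inv_iff[OF K] dest: subgroup.subset)
  ultimately show "h ` normal_closure G A \<subseteq> normal_closure K (h ` A)"
    using image_inv_into_cancel[of h "carrier G" "carrier K"] bij
    by (metis bij_betw_imp_surj_on)
qed

lemma (in group) normal_closure_conj_mono:
  assumes B: "B \<subseteq> carrier G"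
    and conj: "\<And>a. a \<in> A \<Longrightarrow> \<exists>b\<in>B. \<exists>h\<in>carrier G. a = h \<otimes> b \<otimes> inv h"
  shows "normal_closure G A \<subseteq> normal_closure G B"
proof (rule normal_closure_least)
  show "normal_closure G B \<lhd> G" using normal_closure_normal(1)[OF B] .
  then show "A \<subseteq> normal_closure G B"
    using conj normal_closure_normal(2)[OF B] by (fastforce simp: normal_inv_iff)
qed

section \<open>Lifting paths and homotopies to a covering\<close>

text \<open>Agreement of two lifts is an open and closed condition.  If they agree at a point, they lie in the
same sheet nearby; if not, they lie in disjoint sheets.\<close>

lemma covering_lift_unique:
  fixes p :: "'a::topological_space \<Rightarrow> 'b::topological_space"
    and g g' :: "'c::topological_space \<Rightarrow> 'a"
  assumes cov: "covering_space C p S" and T: "connected T" "a \<in> T" "x \<in> T"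
    and g: "continuous_on T g" "g ` T \<subseteq> C" and g': "continuous_on T g'" "g' ` T \<subseteq> C"
    and eq: "\<And>y. y \<in> T \<Longrightarrow> p (g y) = p (g' y)" and a: "g a = g' a"
  shows "g x = g' x"
proof -
  have op: "openin (top_of_set T) (T \<inter> k -` u)"
    if "continuous_on T k" "k ` T \<subseteq> C" "openin (top_of_set C) u" for k :: "'c \<Rightarrow> 'a" and u
    using continuous_openin_preimage[of T k C u] that by auto
  let ?A = "{y \<in> T. g y = g' y}"
  have *: "\<exists>V. openin (top_of_set T) V \<and> y \<in> V \<and> (g y = g' y \<longrightarrow> V \<subseteq> ?A) \<and> (g y \<noteq> g' y \<longrightarrow> V \<subseteq> T - ?A)"
    if y: "y \<in> T" for y
  proof -
    have "p (g y) \<in> S" using cov y g(2) by (auto simp: covering_space_def)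
    then obtain U v where U: "p (g y) \<in> U" and v: "\<Union>v = C \<inter> p -` U"
      "\<forall>u\<in>v. openin (top_of_set C) u" "pairwise disjnt v" "\<forall>u\<in>v. \<exists>q. homeomorphism u U p q"
      using cov unfolding covering_space_def by metis
    have "g y \<in> \<Union>v" "g' y \<in> \<Union>v" unfolding v(1) using y g(2) g'(2) U eq[OF y] by auto
    then obtain w w' where w: "w \<in> v" "g y \<in> w" "w' \<in> v" "g' y \<in> w'" by auto
    have inj: "inj_on p u" if u: "u \<in> v" for u
    proof -
      obtain q where "homeomorphism u U p q" using bspec[OF v(4) u] by (rule exE)
      then show ?thesis by (intro inj_on_inverseI[of u q]) (rule homeomorphism_apply1)
    qed
    let ?V = "(T \<inter> g -` w) \<inter> (T \<inter> g' -` w')"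
    have 1: "openin (top_of_set T) ?V" "y \<in> ?V"
      using op g g' v(2) w y by (blast, auto)
    have 2: "?V \<subseteq> ?A" if "g y = g' y"
    proof -
      have "w = w'" using v(3) w that unfolding pairwise_def disjnt_def by fastforce
      then show ?thesis using inj[OF w(1)] eq by (auto dest: inj_onD)
    qed
    have 3: "?V \<subseteq> T - ?A" if "g y \<noteq> g' y"
    proof -
      have "w \<noteq> w'" using inj[OF w(1)] eq[OF y] w that by (auto dest: inj_onD)
      then have "w \<inter> w' = {}" using v(3) w unfolding pairwise_def disjnt_def by blast
      then show ?thesis by auto
    qed
    show ?thesis using 1 2 3 by blast
  qed
  have "openin (top_of_set T) ?A"
    by (subst openin_subopen) (use * in blast)
  moreover have "openin (top_of_set T) (T - ?A)"
    by (subst openin_subopen) (use * in blast)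
  ultimately have "?A = {} \<or> ?A = T"
    using T(1) unfolding connected_clopen closedin_def by auto
  then show ?thesis using T a by auto
qed

text \<open>The starting point is quantified inside the predicate, at an arbitrary point of \<open>Q\<close>: this makes the
property stable under gluing in either order.\<close>

definition lifts_on ::
  "'a::topological_space set \<Rightarrow> ('a \<Rightarrow> 'b) \<Rightarrow> ('c::topological_space \<Rightarrow> 'b) \<Rightarrow> 'c set \<Rightarrow> bool" where
  "lifts_on C p h Q \<longleftrightarrow> (\<forall>a\<in>Q. \<forall>x\<in>C. p x = h a \<longrightarrow>
     (\<exists>k. continuous_on Q k \<and> k ` Q \<subseteq> C \<and> k a = x \<and> (\<forall>y\<in>Q. p (k y) = h y)))"

text \<open>Lift over the part that contains the starting point, and continue over the other part from a
common point.  The two lifts agree on the connected intersection by uniqueness.\<close>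

lemma lifts_on_glue:
  assumes cov: "covering_space C p S" and L: "lifts_on C p h Q" "lifts_on C p h Q'"
    and cl: "closed Q" "closed Q'" and con: "connected (Q \<inter> Q')" "Q \<inter> Q' \<noteq> {}"
  shows "lifts_on C p h (Q \<union> Q')"
proof -
  have main: "\<exists>k. continuous_on (P \<union> P') k \<and> k ` (P \<union> P') \<subseteq> C \<and> k a = x \<and> (\<forall>y\<in>P \<union> P'. p (k y) = h y)"
    if P: "lifts_on C p h P" "lifts_on C p h P'" "closed P" "closed P'"
      "connected (P \<inter> P')" "c \<in> P \<inter> P'" "a \<in> P" "x \<in> C" "p x = h a" for P P' c a x
  proof -
    obtain k where k: "continuous_on P k" "k ` P \<subseteq> C" "k a = x" "\<forall>y\<in>P. p (k y) = h y"
      using P unfolding lifts_on_def by blast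
    then have "k c \<in> C" "p (k c) = h c" using P by auto
    then obtain k' where k': "continuous_on P' k'" "k' ` P' \<subseteq> C" "k' c = k c" "\<forall>y\<in>P'. p (k' y) = h y"
      using P(2,6) unfolding lifts_on_def by blast
    have agree: "k y = k' y" if "y \<in> P \<inter> P'" for y
    proof (rule covering_lift_unique[OF cov P(5) P(6) that])
      show "continuous_on (P \<inter> P') k" "continuous_on (P \<inter> P') k'"
        using k(1) k'(1) by (blast intro: continuous_on_subset)+
    qed (use k k' in auto)
    have "continuous_on (P \<union> P') (\<lambda>y. if y \<in> P then k y else k' y)"
      by (rule continuous_on_If) (use P k k' agree in auto)
    then show ?thesis
      by (intro exI[of _ "\<lambda>y. if y \<in> P then k y else k' y"]) (use P k k' in auto)
  qed
  obtain c where "c \<in> Q \<inter> Q'" using con by blast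
  note c = this
  show ?thesis unfolding lifts_on_def
  proof (intro ballI impI)
    fix a x assume a: "a \<in> Q \<union> Q'" "x \<in> C" "p x = h a"
    show "\<exists>k. continuous_on (Q \<union> Q') k \<and> k ` (Q \<union> Q') \<subseteq> C \<and> k a = x \<and> (\<forall>y\<in>Q \<union> Q'. p (k y) = h y)"
    proof (cases "a \<in> Q")
      case True
      then show ?thesis using main[OF L cl con(1) c True a(2,3)] by blast
    next
      case False
      then have "a \<in> Q'" using a(1) by blast
      then show ?thesis
        using main[OF L(2,1) cl(2,1), of c a x] con(1) c a(2,3) by (simp add: Int_commute Un_commute)
    qed
  qed
qed

lemma lifts_on_evenly_covered:
  assumes h: "continuous_on Q h" "h ` Q \<subseteq> T"
    and v: "\<Union>v = C \<inter> p -` T" "\<forall>u\<in>v. \<exists>q. homeomorphism u T p q"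
  shows "lifts_on C p h Q"
  unfolding lifts_on_def
proof (intro ballI impI)
  fix a x assume a: "a \<in> Q" "x \<in> C" "p x = h a"
  then have "x \<in> \<Union>v" unfolding v(1) using h(2) by auto
  then obtain u where u: "u \<in> v" "x \<in> u" by (rule UnionE)
  obtain q where q: "homeomorphism u T p q" using bspec[OF v(2) u(1)] by (rule exE)
  have qu: "q ` T = u" using q by (simp add: homeomorphism_def)
  have "continuous_on Q (q \<circ> h)"
    using h(1) continuous_on_subset[OF homeomorphism_cont2[OF q] h(2)] by (rule continuous_on_compose)
  moreover have "(q \<circ> h) ` Q \<subseteq> C"
  proof -
    have "(q \<circ> h) ` Q \<subseteq> q ` T" using h(2) by auto
    also have "\<dots> \<subseteq> C" unfolding qu using u(1) v(1) by blast
    finally show ?thesis .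
  qed
  moreover have "(q \<circ> h) a = x" using homeomorphism_apply1[OF q u(2)] a(3) by simp
  moreover have "\<forall>y\<in>Q. p ((q \<circ> h) y) = h y"
    using homeomorphism_apply2[OF q] h(2) by auto
  ultimately show "\<exists>k. continuous_on Q k \<and> k ` Q \<subseteq> C \<and> k a = x \<and> (\<forall>y\<in>Q. p (k y) = h y)"
    by blast
qed

text \<open>A Lebesgue number makes all small rectangles lie over evenly covered sets, where lifting is
immediate.  Gluing along common edges, in one direction to strips and then in the other, gives the
square.\<close>

lemma covering_lift_square:
  fixes p :: "'a::topological_space \<Rightarrow> 'b::topological_space" and h :: "real \<times> real \<Rightarrow> 'b"
  assumes cov: "covering_space C p S"
    and h: "continuous_on ({0..1} \<times> {0..1}) h" "h ` ({0..1} \<times> {0..1}) \<subseteq> S"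
  shows "lifts_on C p h ({0..1} \<times> {0..1})"
proof -
  let ?I = "{0..1::real}"
  define sheets where "sheets T v \<longleftrightarrow> \<Union>v = C \<inter> p -` T \<and> (\<forall>u\<in>v. \<exists>q. homeomorphism u T p q)" for T v
  define \<C> where "\<C> = {V. open V \<and> (\<exists>T v. h ` (?I \<times> ?I \<inter> V) \<subseteq> T \<and> sheets T v)}"
  have cover: "\<exists>V\<in>\<C>. y \<in> V" if y: "y \<in> ?I \<times> ?I" for y
  proof -
    have "h y \<in> S" using h(2) y by blast
    then obtain T v where T: "h y \<in> T" "openin (top_of_set S) T" and v: "sheets T v"
      using cov unfolding covering_space_def sheets_def by metis
    have "openin (top_of_set (?I \<times> ?I)) (?I \<times> ?I \<inter> h -` T)"
      using continuous_openin_preimage[OF h(1) _ T(2)] h(2) by auto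
    then obtain V where "open V" "?I \<times> ?I \<inter> h -` T = ?I \<times> ?I \<inter> V"
      by (auto simp: openin_open)
    moreover have "h ` (?I \<times> ?I \<inter> V) \<subseteq> T" "y \<in> V" using calculation T(1) y by blast+
    ultimately show ?thesis using v unfolding \<C>_def by blast
  qed
  obtain \<epsilon> where \<epsilon>: "\<epsilon> > 0" "\<And>Q. \<lbrakk>Q \<subseteq> ?I \<times> ?I; diameter Q < \<epsilon>\<rbrakk> \<Longrightarrow> \<exists>V\<in>\<C>. Q \<subseteq> V"
  proof (rule Lebesgue_number_lemma[of "?I \<times> ?I" \<C>])
    show "\<C> \<noteq> {}" using cover[of "(0,0)"] by auto
    show "?I \<times> ?I \<subseteq> \<Union>\<C>" using cover by blast
  qed (auto simp: \<C>_def compact_Times)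
  have small: "lifts_on C p h Q" if Q: "Q \<subseteq> ?I \<times> ?I" "diameter Q < \<epsilon>" for Q
  proof -
    obtain V where V: "V \<in> \<C>" "Q \<subseteq> V" using \<epsilon>(2)[OF Q] by blast
    then obtain T v where T: "h ` (?I \<times> ?I \<inter> V) \<subseteq> T" and v: "sheets T v"
      unfolding \<C>_def by blast
    have "h ` Q \<subseteq> T" using T V(2) Q(1) by blast
    with continuous_on_subset[OF h(1) Q(1)] show ?thesis
      using v unfolding sheets_def by (intro lifts_on_evenly_covered[where v = v]) auto
  qed
  have rect: "lifts_on C p h ({a..b} \<times> {c..d})"
    if "0 \<le> a" "a \<le> b" "b \<le> 1" "0 \<le> c" "c \<le> d" "d \<le> 1" "b - a < \<epsilon> / 3" "d - c < \<epsilon> / 3" for a b c d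
  proof (rule small)
    show "{a..b} \<times> {c..d} \<subseteq> ?I \<times> ?I" using that by auto
    have "diameter ({a..b} \<times> {c..d}) \<le> 2 * \<epsilon> / 3"
    proof (rule diameter_le)
      fix x y assume "x \<in> {a..b} \<times> {c..d}" "y \<in> {a..b} \<times> {c..d}"
      then have "\<bar>fst x - fst y\<bar> \<le> \<epsilon> / 3" "\<bar>snd x - snd y\<bar> \<le> \<epsilon> / 3"
        using that(7,8) unfolding mem_Times_iff atLeastAtMost_iff by linarith+
      moreover have "norm (x - y) \<le> \<bar>fst x - fst y\<bar> + \<bar>snd x - snd y\<bar>"
        using norm_Pair_le[of "fst x - fst y" "snd x - snd y"] by (simp add: minus_prod_def)
      ultimately show "norm (x - y) \<le> 2 * \<epsilon> / 3" by linarith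
    qed (use \<epsilon>(1) in auto)
    then show "diameter ({a..b} \<times> {c..d}) < \<epsilon>" using \<epsilon>(1) by linarith
  qed
  have strip: "lifts_on C p h ({a..b} \<times> ?I)"
    if ab: "0 \<le> a" "a \<le> b" "b \<le> 1" "b - a < \<epsilon> / 3" for a b
  proof -
    have "0 \<le> (0::real) \<longrightarrow> (0::real) \<le> 1 \<longrightarrow> (1::real) \<le> 1 \<longrightarrow> lifts_on C p h ({a..b} \<times> ?I)"
      using zero_le_one[where 'a = real]
    proof (induction rule: Bolzano[of 0 1
        "\<lambda>c d. 0 \<le> c \<longrightarrow> c \<le> d \<longrightarrow> d \<le> 1 \<longrightarrow> lifts_on C p h ({a..b} \<times> {c..d})"])
      case (trans c d e)
      show ?case
      proof (intro impI)
        assume cde: "0 \<le> c" "c \<le> e" "e \<le> 1"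
        have "{a..b} \<times> {c..e} = {a..b} \<times> {c..d} \<union> {a..b} \<times> {d..e}" using trans by auto
        moreover have int: "({a..b} \<times> {c..d}) \<inter> ({a..b} \<times> {d..e}) = {a..b} \<times> {d}"
          using trans by auto
        moreover have "lifts_on C p h ({a..b} \<times> {c..d} \<union> {a..b} \<times> {d..e})"
          by (rule lifts_on_glue[OF cov]) (use trans cde ab in \<open>auto simp: int closed_Times intro: connected_Times\<close>)
        ultimately show "lifts_on C p h ({a..b} \<times> {c..e})" by simp
      qed
    next
      case (local x)
      show ?case by (rule exI[of _ "\<epsilon> / 3"]) (use \<epsilon>(1) rect ab in auto)
    qed
    then show ?thesis by simp
  qed
  have "0 \<le> (0::real) \<longrightarrow> (0::real) \<le> 1 \<longrightarrow> (1::real) \<le> 1 \<longrightarrow> lifts_on C p h (?I \<times> ?I)"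
    using zero_le_one[where 'a = real]
  proof (induction rule: Bolzano[of 0 1
      "\<lambda>c d. 0 \<le> c \<longrightarrow> c \<le> d \<longrightarrow> d \<le> 1 \<longrightarrow> lifts_on C p h ({c..d} \<times> ?I)"])
    case (trans c d e)
    show ?case
    proof (intro impI)
      assume cde: "0 \<le> c" "c \<le> e" "e \<le> 1"
      have "{c..e} \<times> ?I = {c..d} \<times> ?I \<union> {d..e} \<times> ?I" using trans by auto
      moreover have int: "({c..d} \<times> ?I) \<inter> ({d..e} \<times> ?I) = {d} \<times> ?I"
        using trans by auto
      moreover have "lifts_on C p h ({c..d} \<times> ?I \<union> {d..e} \<times> ?I)"
        by (rule lifts_on_glue[OF cov]) (use trans cde in \<open>auto simp: int closed_Times intro: connected_Times\<close>)
      ultimately show "lifts_on C p h ({c..e} \<times> ?I)" by simp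
    qed
  next
    case (local x)
    show ?case by (rule exI[of _ "\<epsilon> / 3"]) (use \<epsilon>(1) strip in auto)
  qed
  then show ?thesis by simp
qed

lemma covering_lift_path:
  fixes p :: "'a::topological_space \<Rightarrow> 'b::topological_space"
  assumes cov: "covering_space C p S" and g: "path g" "path_image g \<subseteq> S"
    and x: "x \<in> C" "p x = pathstart g"
  obtains q where "path q" "path_image q \<subseteq> C" "pathstart q = x" "\<And>t. t \<in> {0..1} \<Longrightarrow> p (q t) = g t"
proof -
  have "lifts_on C p (g \<circ> snd) ({0..1::real} \<times> {0..1})"
  proof (rule covering_lift_square[OF cov])
    show "continuous_on ({0..1::real} \<times> {0..1}) (g \<circ> snd)"
      by (rule continuous_on_compose) (use g in \<open>auto simp: path_def intro: continuous_intros\<close>)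
  qed (use g in \<open>auto simp: path_image_def\<close>)
  from this[unfolded lifts_on_def, THEN bspec, of "(0, 0)", THEN bspec, OF _ x(1)] x(2)
  have "\<exists>k. continuous_on ({0..1::real} \<times> {0..1}) k \<and> k ` ({0..1} \<times> {0..1}) \<subseteq> C \<and> k (0, 0) = x \<and>
    (\<forall>y\<in>{0..1} \<times> {0..1}. p (k y) = (g \<circ> snd) y)"
    by (simp add: pathstart_def)
  then obtain k where k: "continuous_on ({0..1::real} \<times> {0..1}) k" "k ` ({0..1} \<times> {0..1}) \<subseteq> C" "k (0, 0) = x"
    "\<forall>y\<in>{0..1} \<times> {0..1}. p (k y) = (g \<circ> snd) y" by (elim exE conjE)
  show thesis
  proof
    show "path (k \<circ> Pair 0)" unfolding path_def
      by (rule continuous_on_compose) (use k(1) in \<open>auto intro!: continuous_intros elim: continuous_on_subset\<close>)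
  qed (use k in \<open>auto simp: path_image_def pathstart_def\<close>)
qed

text \<open>Lift the homotopy.  Three sides of the square are forced by uniqueness: the side over the first path,
and the two sides over constant paths.  Then the fourth one is the other given lift.\<close>

lemma covering_lift_homotopic_paths:
  fixes p :: "'a::topological_space \<Rightarrow> 'b::topological_space"
  assumes cov: "covering_space C p S" and hom: "homotopic_paths S (p \<circ> q) (p \<circ> q')"
    and q: "path q" "path_image q \<subseteq> C" and q': "path q'" "path_image q' \<subseteq> C"
    and start: "pathstart q = pathstart q'"
  shows "homotopic_paths C q q'"
proof -
  let ?I = "{0..1::real}"
  obtain h where h: "continuous_on (?I \<times> ?I) h" "h ` (?I \<times> ?I) \<subseteq> S"
    and h0: "\<And>x. x \<in> ?I \<Longrightarrow> h (0, x) = p (q x)" and h1: "\<And>x. x \<in> ?I \<Longrightarrow> h (1, x) = p (q' x)"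
    and hs: "\<And>t. t \<in> ?I \<Longrightarrow> h (t, 0) = p (q 0)" and hf: "\<And>t. t \<in> ?I \<Longrightarrow> h (t, 1) = p (q 1)"
    using hom unfolding homotopic_paths image_subset_iff_funcset[symmetric]
    by (clarsimp simp: pathstart_def pathfinish_def)
  have "q 0 \<in> C" using q(2) by (auto simp: path_image_def)
  then obtain k where k: "continuous_on (?I \<times> ?I) k" "k ` (?I \<times> ?I) \<subseteq> C" "k (0, 0) = q 0"
    "\<And>s t. s \<in> ?I \<Longrightarrow> t \<in> ?I \<Longrightarrow> p (k (s, t)) = h (s, t)"
    using covering_lift_square[OF cov h, unfolded lifts_on_def, THEN bspec, of "(0, 0)", THEN bspec, of "q 0"]
      h0[of 0] by auto
  have slice1: "continuous_on ?I (\<lambda>t. k (s, t))" if "s \<in> ?I" for s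
    by (rule continuous_on_compose2[OF k(1)]) (use that in \<open>auto intro!: continuous_intros\<close>)
  have slice2: "continuous_on ?I (\<lambda>s. k (s, t))" if "t \<in> ?I" for t
    by (rule continuous_on_compose2[OF k(1)]) (use that in \<open>auto intro!: continuous_intros\<close>)
  note uniq = covering_lift_unique[OF cov, of ?I 0]
  have k0: "k (0, x) = q x" if "x \<in> ?I" for x
    by (rule uniq[of x "\<lambda>x. k (0, x)"])
      (use that k q h0 slice1 in \<open>auto simp: path_def path_image_def\<close>)
  have ks: "k (s, 0) = q 0" if "s \<in> ?I" for s
    by (rule uniq[of s "\<lambda>s. k (s, 0)" "\<lambda>_. q 0"])
      (use that k hs slice2 \<open>q 0 \<in> C\<close> in auto)
  have kf: "k (s, 1) = q 1" if "s \<in> ?I" for s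
    by (rule uniq[of s "\<lambda>s. k (s, 1)" "\<lambda>_. q 1"])
      (use that k hf slice2 k0 q in \<open>auto simp: path_image_def\<close>)
  have k1: "k (1, x) = q' x" if "x \<in> ?I" for x
    by (rule uniq[of x "\<lambda>x. k (1, x)"])
      (use that k q' h1 slice1 ks start in \<open>auto simp: path_def path_image_def pathstart_def\<close>)
  show ?thesis
    unfolding homotopic_paths
    by (rule exI[of _ k]) (use k k0 k1 ks kf in \<open>auto simp: pathstart_def pathfinish_def\<close>)
qed

section \<open>The fundamental group\<close>

text \<open>A path in any space is the image of the standard path in the interval.  Path homotopies that hold
for geometric reasons in the interval are thereby transported to arbitrary spaces.\<close>

lemma homotopic_paths_image_of_interval:
  fixes p :: "real \<Rightarrow> 'a::topological_space"
  assumes p: "path p" "path_image p \<subseteq> S" and "homotopic_paths {0..1::real} l l'"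
  shows "homotopic_paths S (p \<circ> l) (p \<circ> l')"
  by (rule homotopic_paths_continuous_image[OF assms(3)])
     (use p in \<open>auto simp: path_def path_image_def\<close>)

lemma homotopic_paths_join_const:
  fixes p :: "real \<Rightarrow> 'a::topological_space"
  assumes p: "path p" "path_image p \<subseteq> S"
  shows "homotopic_paths S ((\<lambda>_. pathstart p) +++ p) p"
    and "homotopic_paths S (reversepath p +++ p) (\<lambda>_. pathfinish p)"
proof -
  let ?l = "linepath (0::real) 1"
  have l01: "path ?l" "path_image ?l \<subseteq> {0..1}"
    unfolding path_image_linepath by (auto simp: closed_segment_eq_real_ivl)
  have l: "p \<circ> ?l = p" "p \<circ> reversepath ?l = reversepath p"
    "p \<circ> linepath 0 0 = (\<lambda>_. pathstart p)" "p \<circ> linepath 1 1 = (\<lambda>_. pathfinish p)"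
    by (auto simp: fun_eq_iff linepath_def reversepath_def pathstart_def pathfinish_def)
  note im = homotopic_paths_image_of_interval[OF p]
  show "homotopic_paths S ((\<lambda>_. pathstart p) +++ p) p"
    using im[OF homotopic_paths_lid[OF l01]] unfolding path_compose_join by (simp add: l)
  show "homotopic_paths S (reversepath p +++ p) (\<lambda>_. pathfinish p)"
    using im[OF homotopic_paths_linv[OF l01]] unfolding path_compose_join
    by (simp add: l del: reversepath_linepath)
qed

lemma mem_path_class: "q \<in> path_class S p \<longleftrightarrow> homotopic_paths S p q"
  by (simp add: path_class_def)

lemma path_class_eqI:
  assumes "homotopic_paths S p q"
  shows "path_class S p = path_class S q"
proof -
  have "homotopic_paths S p h \<longleftrightarrow> homotopic_paths S q h" for h
    using homotopic_paths_trans[OF assms, of h]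
      homotopic_paths_trans[OF assms[THEN homotopic_paths_sym], of h] by blast
  then show ?thesis by (simp add: path_class_def)
qed

lemma path_class_eqD:
  assumes "path_class S p = path_class S q" "path q" "path_image q \<subseteq> S"
  shows "homotopic_paths S p q"
proof -
  have "q \<in> path_class S q" using assms(2,3) by (simp add: mem_path_class)
  then show ?thesis using assms(1) mem_path_class[of q S p] by simp
qed

lemma path_class_memD: "q \<in> path_class S p \<Longrightarrow> path_class S q = path_class S p"
  using path_class_eqI[of S p q] by (simp add: mem_path_class)

lemma carrier_fundamental_group:
  "g \<in> carrier (fundamental_group S x) \<longleftrightarrow>
    (\<exists>p. g = path_class S p \<and> path p \<and> path_image p \<subseteq> S \<and> pathstart p = x \<and> pathfinish p = x)"
  unfolding fundamental_group_def by auto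

lemma carrier_fundamental_groupE:
  assumes "g \<in> carrier (fundamental_group S x)"
  obtains p where "g = path_class S p" "path p" "path_image p \<subseteq> S" "pathstart p = x" "pathfinish p = x"
  using assms unfolding carrier_fundamental_group by blast

lemma mult_fundamental_group:
  assumes "path p" "path_image p \<subseteq> S" "path q" "path_image q \<subseteq> S" "pathfinish p = pathstart q"
  shows "path_class S p \<otimes>\<^bsub>fundamental_group S x\<^esub> path_class S q = path_class S (p +++ q)"
proof -
  let ?M = "{h. \<exists>p'\<in>path_class S p. \<exists>q'\<in>path_class S q. homotopic_paths S (p' +++ q') h}"
  have "h \<in> ?M \<longleftrightarrow> homotopic_paths S (p +++ q) h" for h
  proof
    assume "h \<in> ?M"
    then obtain p' q' where h: "homotopic_paths S p p'" "homotopic_paths S q q'"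
      "homotopic_paths S (p' +++ q') h"
      by (auto simp: mem_path_class)
    show "homotopic_paths S (p +++ q) h"
      using homotopic_paths_trans[OF homotopic_paths_join[OF h(1,2) assms(5)] h(3)] .
  next
    assume "homotopic_paths S (p +++ q) h"
    moreover have "p \<in> path_class S p" "q \<in> path_class S q"
      using assms by (simp_all add: mem_path_class)
    ultimately show "h \<in> ?M" by blast
  qed
  then have "?M = path_class S (p +++ q)" by (auto simp: mem_path_class)
  then show ?thesis by (simp add: fundamental_group_def)
qed

lemma one_fundamental_group: "\<one>\<^bsub>fundamental_group S x\<^esub> = path_class S (\<lambda>_. x)"
  by (simp add: fundamental_group_def)

lemma const_path: "path (\<lambda>_. x)" "path_image (\<lambda>_. x) = {x}" "pathstart (\<lambda>_. x) = x" "pathfinish (\<lambda>_. x) = x"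
  by (auto simp: path_def path_image_def pathstart_def pathfinish_def)

lemma reversepath_in_carrier:
  assumes p: "path p" "path_image p \<subseteq> S" "pathstart p = x" "pathfinish p = x"
  shows "path_class S (reversepath p) \<in> carrier (fundamental_group S x)"
    "path_class S (reversepath p) \<otimes>\<^bsub>fundamental_group S x\<^esub> path_class S p = \<one>\<^bsub>fundamental_group S x\<^esub>"
proof -
  show "path_class S (reversepath p) \<in> carrier (fundamental_group S x)"
    unfolding carrier_fundamental_group
    by (rule exI[of _ "reversepath p"]) (use p in auto)
  show "path_class S (reversepath p) \<otimes>\<^bsub>fundamental_group S x\<^esub> path_class S p = \<one>\<^bsub>fundamental_group S x\<^esub>"
    using p homotopic_paths_join_const(2)[OF p(1,2)]
    by (simp add: mult_fundamental_group one_fundamental_group path_class_eqI)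
qed

lemma group_fundamental_group:
  assumes x: "x \<in> S"
  shows "group (fundamental_group S x)"
proof (rule groupI)
  let ?G = "fundamental_group S x"
  fix a b assume "a \<in> carrier ?G" "b \<in> carrier ?G"
  then obtain p q where p: "a = path_class S p" "path p" "path_image p \<subseteq> S" "pathstart p = x" "pathfinish p = x"
    and q: "b = path_class S q" "path q" "path_image q \<subseteq> S" "pathstart q = x" "pathfinish q = x"
    by (elim carrier_fundamental_groupE)
  show "a \<otimes>\<^bsub>?G\<^esub> b \<in> carrier ?G"
    unfolding carrier_fundamental_group
    by (rule exI[of _ "p +++ q"]) (use p q in \<open>auto simp: mult_fundamental_group path_image_join\<close>)
  fix c assume "c \<in> carrier ?G"
  then obtain r where r: "c = path_class S r" "path r" "path_image r \<subseteq> S" "pathstart r = x" "pathfinish r = x"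
    by (elim carrier_fundamental_groupE)
  show "a \<otimes>\<^bsub>?G\<^esub> b \<otimes>\<^bsub>?G\<^esub> c = a \<otimes>\<^bsub>?G\<^esub> (b \<otimes>\<^bsub>?G\<^esub> c)"
    using p q r homotopic_paths_assoc[of p S q r]
    by (simp add: mult_fundamental_group path_image_join path_class_eqI)
next
  let ?G = "fundamental_group S x"
  show "\<one>\<^bsub>?G\<^esub> \<in> carrier ?G"
    unfolding carrier_fundamental_group one_fundamental_group
    by (rule exI[of _ "\<lambda>_. x"]) (use x in \<open>simp add: const_path\<close>)
  fix a assume "a \<in> carrier ?G"
  then obtain p where p: "a = path_class S p" "path p" "path_image p \<subseteq> S" "pathstart p = x" "pathfinish p = x"
    by (rule carrier_fundamental_groupE)
  show "\<one>\<^bsub>?G\<^esub> \<otimes>\<^bsub>?G\<^esub> a = a"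
    using p x homotopic_paths_join_const(1)[OF p(2,3)]
    by (simp add: one_fundamental_group mult_fundamental_group const_path path_class_eqI)
  show "\<exists>b\<in>carrier ?G. b \<otimes>\<^bsub>?G\<^esub> a = \<one>\<^bsub>?G\<^esub>"
    using reversepath_in_carrier[OF p(2-5)] p(1) by blast
qed

lemma inv_fundamental_group:
  assumes p: "path p" "path_image p \<subseteq> S" "pathstart p = x" "pathfinish p = x"
  shows "inv\<^bsub>fundamental_group S x\<^esub> (path_class S p) = path_class S (reversepath p)"
proof (rule group.inv_equality)
  have "x \<in> S" using p pathstart_in_path_image by blast
  then show "group (fundamental_group S x)" by (rule group_fundamental_group)
  show "path_class S p \<in> carrier (fundamental_group S x)"
    using p by (auto simp: carrier_fundamental_group)
qed (use reversepath_in_carrier[OF p] in auto)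

lemma mult_fundamental_group_empty:
  "a \<otimes>\<^bsub>fundamental_group S x\<^esub> {} = {}" "{} \<otimes>\<^bsub>fundamental_group S x\<^esub> b = {}"
  by (simp_all add: fundamental_group_def)

text \<open>An element of the class is homotopic in \<open>- B\<close> to the representative, which is therefore itself a
path in \<open>- B\<close>.\<close>

lemma loop_around_only_in_carrier:
  assumes g: "loop_around_only B z b g" "g \<noteq> {}"
  shows "g \<in> carrier (fundamental_group (- B) z)"
proof -
  obtain c \<alpha> where c: "pathstart \<alpha> = z" "pathfinish \<alpha> = pathstart c"
    "g = path_class (- B) (\<alpha> +++ c +++ reversepath \<alpha>)"
    using g(1) unfolding loop_around_only_def by (elim bexE exE conjE case_prodE) blast
  then obtain h where "homotopic_paths (- B) (\<alpha> +++ c +++ reversepath \<alpha>) h"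
    using g(2) by (auto simp: path_class_def)
  then have "path (\<alpha> +++ c +++ reversepath \<alpha>)" "path_image (\<alpha> +++ c +++ reversepath \<alpha>) \<subseteq> - B"
    using homotopic_paths_imp_path homotopic_paths_imp_subset by blast+
  then show ?thesis
    unfolding carrier_fundamental_group
    by (intro exI[of _ "\<alpha> +++ c +++ reversepath \<alpha>"]) (use c in simp)
qed

section \<open>Monodromy of a covering with a labelled fibre\<close>

locale labelled_covering =
  fixes C :: "'a::topological_space set" and f :: "'a \<Rightarrow> 'b::topological_space" and Z z
    and zs :: "nat \<Rightarrow> 'a" and n :: nat
  assumes cov: "covering_space C f Z" and z: "z \<in> Z" and n: "0 < n"
    and zs: "bij_betw zs {1..n} (C \<inter> f -` {z})"
begin

abbreviation "G \<equiv> fundamental_group Z z"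
abbreviation "\<tau> \<equiv> monodromy C f n zs"
abbreviation "PC \<equiv> fundamental_group C (zs 1)"

sublocale group G
  using z by (rule group_fundamental_group)

lemma zs_mem: "i \<in> {1..n} \<Longrightarrow> zs i \<in> C" "i \<in> {1..n} \<Longrightarrow> f (zs i) = z"
  using zs unfolding bij_betw_def by auto

lemma zs_eq_iff: "i \<in> {1..n} \<Longrightarrow> j \<in> {1..n} \<Longrightarrow> zs i = zs j \<longleftrightarrow> i = j"
  using zs unfolding bij_betw_def by (auto dest: inj_onD)

lemma path_map:
  assumes "path q" "path_image q \<subseteq> C"
  shows "path (f \<circ> q)" "path_image (f \<circ> q) \<subseteq> Z"
    "pathstart (f \<circ> q) = f (pathstart q)" "pathfinish (f \<circ> q) = f (pathfinish q)"
proof -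
  have "continuous_on C f" "f ` C = Z" using cov by (auto simp: covering_space_def)
  then show "path (f \<circ> q)" "path_image (f \<circ> q) \<subseteq> Z"
    using assms by (auto simp: path_image_compose intro: path_continuous_image continuous_on_subset)
qed (auto simp: pathstart_def pathfinish_def)

lemma is_lift_path_class:
  assumes "is_lift C f g x q" "g \<in> carrier G"
  shows "g = path_class Z (f \<circ> q)"
  using assms path_class_memD by (metis carrier_fundamental_groupE is_lift_def)

lemma is_lift_self:
  assumes "path q" "path_image q \<subseteq> C" "pathstart q = x"
  shows "is_lift C f (path_class Z (f \<circ> q)) x q"
  using assms path_map[OF assms(1,2)] unfolding is_lift_def by (simp add: mem_path_class)

lemma lift_exists:
  assumes g: "g \<in> carrier G" and i: "i \<in> {1..n}"
  obtains q j where "is_lift C f g (zs i) q" "j \<in> {1..n}" "pathfinish q = zs j"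
proof -
  obtain p where p: "g = path_class Z p" "path p" "path_image p \<subseteq> Z" "pathstart p = z" "pathfinish p = z"
    using g by (rule carrier_fundamental_groupE)
  obtain q where q: "path q" "path_image q \<subseteq> C" "pathstart q = zs i" "\<And>t. t \<in> {0..1} \<Longrightarrow> f (q t) = p t"
    using covering_lift_path[OF cov p(2,3), of "zs i"] zs_mem[OF i] p(4) by metis
  have "homotopic_paths Z p (f \<circ> q)"
    by (rule homotopic_paths_eq) (use p q in auto)
  then have "is_lift C f g (zs i) q"
    using q p(1) unfolding is_lift_def by (simp add: mem_path_class)
  moreover have "pathfinish q \<in> C \<inter> f -` {z}"
    using q(4)[of 1] q(2) p(5) pathfinish_in_path_image[of q] by (auto simp: pathfinish_def)
  then have "pathfinish q \<in> zs ` {1..n}" using zs by (simp add: bij_betw_def)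
  then obtain j where "j \<in> {1..n}" "pathfinish q = zs j" by blast
  ultimately show thesis using that by blast
qed

lemma lift_homotopic:
  assumes g: "g \<in> carrier G" and q: "is_lift C f g x q" and q': "is_lift C f g x q'"
  shows "homotopic_paths C q q'"
proof (rule covering_lift_homotopic_paths[OF cov])
  show "homotopic_paths Z (f \<circ> q) (f \<circ> q')"
    using is_lift_path_class[OF q g] q' by (auto simp: is_lift_def mem_path_class)
qed (use q q' in \<open>auto simp: is_lift_def\<close>)

lemma monodromy_eqI:
  assumes g: "g \<in> carrier G" and ij: "i \<in> {1..n}" "j \<in> {1..n}"
    and q: "is_lift C f g (zs i) q" "pathfinish q = zs j"
  shows "\<tau> g i = j"
proof -
  have "(THE j. j \<in> {1..n} \<and> (\<exists>q. is_lift C f g (zs i) q \<and> pathfinish q = zs j)) = j"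
  proof (rule the_equality)
    fix j' assume j': "j' \<in> {1..n} \<and> (\<exists>q. is_lift C f g (zs i) q \<and> pathfinish q = zs j')"
    then obtain q' where "is_lift C f g (zs i) q'" "pathfinish q' = zs j'" by blast
    then have "zs j' = zs j"
      using homotopic_paths_imp_pathfinish[OF lift_homotopic[OF g q(1)]] q(2) by metis
    then show "j' = j" using j' ij zs_eq_iff by blast
  qed (use ij q in blast)
  then show ?thesis using ij unfolding monodromy_def by auto
qed

lemma monodromy_lift:
  assumes g: "g \<in> carrier G" and i: "i \<in> {1..n}"
  obtains q where "is_lift C f g (zs i) q" "pathfinish q = zs (\<tau> g i)"
  using lift_exists[OF assms] monodromy_eqI[OF assms] by metis

lemma monodromy_closed: "g \<in> carrier G \<Longrightarrow> i \<in> {1..n} \<Longrightarrow> \<tau> g i \<in> {1..n}"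
  using lift_exists monodromy_eqI by metis

lemma monodromy_path_class:
  assumes ij: "i \<in> {1..n}" "j \<in> {1..n}"
    and q: "path q" "path_image q \<subseteq> C" "pathstart q = zs i" "pathfinish q = zs j"
  shows "path_class Z (f \<circ> q) \<in> carrier G" "\<tau> (path_class Z (f \<circ> q)) i = j"
proof -
  show "path_class Z (f \<circ> q) \<in> carrier G"
    unfolding carrier_fundamental_group
    by (rule exI[of _ "f \<circ> q"]) (use path_map[OF q(1,2)] q zs_mem ij in auto)
  then show "\<tau> (path_class Z (f \<circ> q)) i = j"
    using monodromy_eqI ij q is_lift_self by blast
qed

lemma monodromy_one: "\<tau> \<one>\<^bsub>G\<^esub> i = i"
proof (cases "i \<in> {1..n}")
  case True
  have "f \<circ> (\<lambda>_. zs i) = (\<lambda>_. z)" using zs_mem[OF True] by auto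
  then show ?thesis
    using monodromy_path_class(2)[OF True True, of "\<lambda>_. zs i"] zs_mem[OF True]
    by (simp add: const_path one_fundamental_group)
qed (auto simp: monodromy_def)

lemma lift_mult:
  assumes q: "is_lift C f g x q" "pathfinish q = y" and q': "is_lift C f g' y q'"
    and g: "g \<in> carrier G" "g' \<in> carrier G"
  shows "is_lift C f (g \<otimes>\<^bsub>G\<^esub> g') x (q +++ q')"
proof -
  have "f \<circ> (q +++ q') \<in> g \<otimes>\<^bsub>G\<^esub> g'"
  proof -
    have p: "path (f \<circ> q)" "path_image (f \<circ> q) \<subseteq> Z" "path (f \<circ> q')" "path_image (f \<circ> q') \<subseteq> Z"
      "pathfinish (f \<circ> q) = pathstart (f \<circ> q')"
      using path_map q q' unfolding is_lift_def by auto
    have "g \<otimes>\<^bsub>G\<^esub> g' = path_class Z ((f \<circ> q) +++ (f \<circ> q'))"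
      using is_lift_path_class[OF q(1) g(1)] is_lift_path_class[OF q' g(2)] mult_fundamental_group[OF p] by metis
    then show ?thesis using p by (simp add: path_compose_join mem_path_class path_image_join)
  qed
  then show ?thesis using q q' unfolding is_lift_def by (auto simp: path_image_join)
qed

lemma monodromy_mult:
  assumes g: "g \<in> carrier G" "g' \<in> carrier G"
  shows "\<tau> (g \<otimes>\<^bsub>G\<^esub> g') i = \<tau> g' (\<tau> g i)"
proof (cases "i \<in> {1..n}")
  case i: True
  then have j: "\<tau> g i \<in> {1..n}" using monodromy_closed g by blast
  obtain q where q: "is_lift C f g (zs i) q" "pathfinish q = zs (\<tau> g i)"
    using monodromy_lift[OF g(1) i] .
  obtain q' where q': "is_lift C f g' (zs (\<tau> g i)) q'" "pathfinish q' = zs (\<tau> g' (\<tau> g i))"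
    using monodromy_lift[OF g(2) j] .
  show ?thesis
    by (rule monodromy_eqI[OF _ i _ lift_mult[OF q q'(1) g]])
       (use g q' j monodromy_closed in auto)
qed (simp only: monodromy_def if_False)

lemma induced_map_path_class:
  assumes "path q" "path_image q \<subseteq> C"
  shows "induced_map Z f (path_class C q) = path_class Z (f \<circ> q)"
proof -
  have hom: "homotopic_paths Z (f \<circ> q) (f \<circ> q')" if "homotopic_paths C q q'" for q'
    using that by (rule homotopic_paths_continuous_image) (use cov in \<open>auto simp: covering_space_def\<close>)
  have "homotopic_paths Z (f \<circ> q) h \<longleftrightarrow> h \<in> induced_map Z f (path_class C q)" for h
  proof
    assume "homotopic_paths Z (f \<circ> q) h"
    moreover have "q \<in> path_class C q" using assms by (simp add: mem_path_class)
    ultimately show "h \<in> induced_map Z f (path_class C q)" unfolding induced_map_def by blast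
  next
    assume "h \<in> induced_map Z f (path_class C q)"
    then obtain q' where "homotopic_paths C q q'" "homotopic_paths Z (f \<circ> q') h"
      unfolding induced_map_def by (auto simp: mem_path_class)
    then show "homotopic_paths Z (f \<circ> q) h" using hom homotopic_paths_trans by blast
  qed
  then have "h \<in> path_class Z (f \<circ> q) \<longleftrightarrow> h \<in> induced_map Z f (path_class C q)" for h
    unfolding mem_path_class .
  then show ?thesis by blast
qed

lemma group_PC: "group PC"
  using zs_mem(1)[of 1] n by (intro group_fundamental_group) auto

sublocale right_action G "{1..n}" \<tau>
  by unfold_locales (use monodromy_closed monodromy_one monodromy_mult in auto)

abbreviation "H \<equiv> {g \<in> carrier G. \<tau> g 1 = 1}"

lemma induced_map_hom: "induced_map Z f \<in> hom PC (G\<lparr>carrier := H\<rparr>)"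
proof (rule homI)
  have 1: "1 \<in> {1..n}" using n by auto
  fix a assume "a \<in> carrier PC"
  then obtain p where p: "a = path_class C p" "path p" "path_image p \<subseteq> C"
    "pathstart p = zs 1" "pathfinish p = zs 1"
    by (rule carrier_fundamental_groupE)
  show "induced_map Z f a \<in> carrier (G\<lparr>carrier := H\<rparr>)"
    using induced_map_path_class[OF p(2,3)] monodromy_path_class[OF 1 1 p(2-5)] p(1) by simp
  fix b assume "b \<in> carrier PC"
  then obtain q where q: "b = path_class C q" "path q" "path_image q \<subseteq> C"
    "pathstart q = zs 1" "pathfinish q = zs 1"
    by (rule carrier_fundamental_groupE)
  show "induced_map Z f (a \<otimes>\<^bsub>PC\<^esub> b) = induced_map Z f a \<otimes>\<^bsub>G\<lparr>carrier := H\<rparr>\<^esub> induced_map Z f b"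
    using p q path_map[OF p(2,3)] path_map[OF q(2,3)]
    by (simp add: mult_fundamental_group induced_map_path_class path_image_join path_compose_join)
qed

text \<open>Homotopy lifting gives injectivity; an element fixes the label \<open>1\<close> exactly when its lift closes up,
which gives the image.\<close>

lemma induced_map_iso: "induced_map Z f \<in> iso PC (G\<lparr>carrier := H\<rparr>)"
proof -
  have 1: "1 \<in> {1..n}" using n by auto
  have "inj_on (induced_map Z f) (carrier PC)"
  proof (rule inj_onI)
    fix a b assume ab: "a \<in> carrier PC" "b \<in> carrier PC" "induced_map Z f a = induced_map Z f b"
    obtain p where p: "a = path_class C p" "path p" "path_image p \<subseteq> C"
      "pathstart p = zs 1" "pathfinish p = zs 1"
      using ab(1) by (rule carrier_fundamental_groupE)
    obtain q where q: "b = path_class C q" "path q" "path_image q \<subseteq> C"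
      "pathstart q = zs 1" "pathfinish q = zs 1"
      using ab(2) by (rule carrier_fundamental_groupE)
    have "homotopic_paths Z (f \<circ> p) (f \<circ> q)"
      using ab(3) p q path_map[OF q(2,3)]
      by (intro path_class_eqD) (simp_all add: induced_map_path_class)
    then have "homotopic_paths C p q"
      by (rule covering_lift_homotopic_paths[OF cov]) (use p q in auto)
    then show "a = b" using p q path_class_eqI by blast
  qed
  moreover have "H \<subseteq> induced_map Z f ` carrier PC"
  proof
    fix g assume g: "g \<in> H"
    obtain q where q: "is_lift C f g (zs 1) q" "pathfinish q = zs (\<tau> g 1)"
      using monodromy_lift[of g 1] g 1 by blast
    then have "path q" "path_image q \<subseteq> C" "pathstart q = zs 1" "pathfinish q = zs 1"
      using g by (auto simp: is_lift_def)
    moreover have "g = path_class Z (f \<circ> q)" using is_lift_path_class q g by blast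
    ultimately show "g \<in> induced_map Z f ` carrier PC"
      unfolding image_iff by (intro bexI[of _ "path_class C q"])
        (auto simp: induced_map_path_class carrier_fundamental_group)
  qed
  ultimately show ?thesis
    using induced_map_hom unfolding iso_def bij_betw_def hom_def by auto
qed

end

context labelled_covering
begin

text \<open>The lift of \<open>g\<close> at \<open>zs i\<close> closes up as \<open>g\<close> fixes \<open>i\<close>, so this is a genuine loop, and \<open>f \<circ> \<beta>\<close> is a
loop too since both ends of \<open>\<beta>\<close> lie in the fibre.\<close>

lemma lasso:
  assumes i: "i \<in> {1..n}" and g: "g \<in> carrier G" "\<tau> g i = i"
    and \<beta>: "path \<beta>" "path_image \<beta> \<subseteq> C" "pathstart \<beta> = zs 1" "pathfinish \<beta> = zs i"
    and q: "is_lift C f g (zs i) q"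
  defines "s \<equiv> path_class C (\<beta> +++ q +++ reversepath \<beta>)" and "d \<equiv> path_class Z (f \<circ> \<beta>)"
  shows "s \<in> carrier PC" "induced_map Z f s = d \<otimes>\<^bsub>G\<^esub> g \<otimes>\<^bsub>G\<^esub> inv\<^bsub>G\<^esub> d"
proof -
  have 1: "1 \<in> {1..n}" using n by auto
  obtain q' where q': "is_lift C f g (zs i) q'" "pathfinish q' = zs (\<tau> g i)"
    using monodromy_lift[OF g(1) i] .
  have qf: "pathfinish q = zs i"
    using homotopic_paths_imp_pathfinish[OF lift_homotopic[OF g(1) q q'(1)]] q'(2) g(2) by simp
  have qp: "path q" "path_image q \<subseteq> C" "pathstart q = zs i" using q by (auto simp: is_lift_def)
  have p: "path (\<beta> +++ q +++ reversepath \<beta>)" "path_image (\<beta> +++ q +++ reversepath \<beta>) \<subseteq> C"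
    using \<beta> qp qf by (auto simp: path_image_join)
  show "s \<in> carrier PC"
    unfolding s_def carrier_fundamental_group
    by (rule exI[of _ "\<beta> +++ q +++ reversepath \<beta>"]) (use p \<beta> in auto)
  note fb = path_map[OF \<beta>(1,2)] and fq = path_map[OF qp(1,2)]
  have ends: "pathstart (f \<circ> \<beta>) = z" "pathfinish (f \<circ> \<beta>) = z" "pathstart (f \<circ> q) = z" "pathfinish (f \<circ> q) = z"
    using fb fq \<beta> qp qf zs_mem(2)[OF i] zs_mem(2)[OF 1] by simp_all
  have gq: "g = path_class Z (f \<circ> q)" using is_lift_path_class[OF q g(1)] .
  have d: "d \<in> carrier G" unfolding d_def by (rule monodromy_path_class(1)[OF 1 i \<beta>])
  have "induced_map Z f s = path_class Z ((f \<circ> \<beta>) +++ (f \<circ> q) +++ reversepath (f \<circ> \<beta>))"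
    unfolding s_def by (simp add: induced_map_path_class[OF p] path_compose_join path_compose_reversepath)
  also have "\<dots> = d \<otimes>\<^bsub>G\<^esub> (g \<otimes>\<^bsub>G\<^esub> inv\<^bsub>G\<^esub> d)"
    unfolding d_def gq using fb(1,2) fq(1,2) ends
    by (simp add: inv_fundamental_group mult_fundamental_group path_image_join)
  also have "\<dots> = d \<otimes>\<^bsub>G\<^esub> g \<otimes>\<^bsub>G\<^esub> inv\<^bsub>G\<^esub> d" using d g(1) by (simp add: m_assoc)
  finally show "induced_map Z f s = d \<otimes>\<^bsub>G\<^esub> g \<otimes>\<^bsub>G\<^esub> inv\<^bsub>G\<^esub> d" .
qed

end

section \<open>The puncture kernel in the Schreier basis\<close>

theorem corollary3p4p21:
  fixes X :: "'a::t2_space set" and A :: "('a set \<times> ('a \<Rightarrow> complex)) set"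
    and f :: "'a \<Rightarrow> cp1" and n r :: nat
    and b :: "nat \<Rightarrow> cp1" and B Z :: "cp1 set" and Xop :: "'a set" and z :: cp1 and zs :: "nat \<Rightarrow> 'a"
    and \<gamma> :: "nat \<Rightarrow> (real \<Rightarrow> cp1) set"
    and G :: "(real \<Rightarrow> cp1) set monoid" and H R Y :: "(real \<Rightarrow> cp1) set set"
    and \<tau> :: "(real \<Rightarrow> cp1) set \<Rightarrow> nat \<Rightarrow> nat"
    and k :: "nat \<Rightarrow> nat" and e :: "nat \<Rightarrow> nat \<Rightarrow> nat list"
    and u t :: "nat \<Rightarrow> nat \<Rightarrow> nat" and \<beta> :: "nat \<Rightarrow> nat \<Rightarrow> real \<Rightarrow> 'a"
    and \<delta> E :: "nat \<Rightarrow> nat \<Rightarrow> (real \<Rightarrow> cp1) set" and W :: "nat \<Rightarrow> (real \<Rightarrow> cp1) set"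
  assumes X: "riemann_surface X A" "compact X"
    and f: "branched_cover X A f n" "n > 1"
    and B: "B = branch_points X f" "bij_betw b {1..r} B"
    and Z: "Z = - B" "z \<in> Z"
    and zs: "bij_betw zs {1..n} (X \<inter> f -` {z})"
    and Xop: "Xop = X - f -` B"
    and G: "G = fundamental_group Z z"
    and \<gamma>: "\<forall>i\<in>{1..r}. loop_around_only B z (b i) (\<gamma> i)"
      "free_basis G {1..<r} \<gamma>"
      "foldr (\<lambda>i x. \<gamma> i \<otimes>\<^bsub>G\<^esub> x) [1..<Suc r] \<one>\<^bsub>G\<^esub> = \<one>\<^bsub>G\<^esub>"
    and \<tau>: "\<tau> = monodromy Xop f n zs"
    and H: "H = {g \<in> carrier G. \<tau> g 1 = 1}"
    and \<gamma>1: "\<gamma> 1 \<in> carrier G - H"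
    and e: "\<forall>i\<in>{1..r}. disjoint_cycle_decomposition n (\<tau> (\<gamma> i)) (k i) (e i)"
    and u: "\<forall>i\<in>{1..r}. \<forall>j\<in>{1..k i}. u i j \<in> set (e i j)"
    and \<beta>: "\<forall>i\<in>{1..r}. \<forall>j\<in>{1..k i}. path (\<beta> i j) \<and> path_image (\<beta> i j) \<subseteq> Xop \<and>
        pathstart (\<beta> i j) = zs 1 \<and> pathfinish (\<beta> i j) = zs (u i j)"
    and R: "R = schreier_transversal G {1..<r} \<gamma> H"
    and Y: "Y = schreier_basis G {1..<r} \<gamma> H"
    and t: "\<forall>i\<in>{1..r}. \<forall>j\<in>{1..k i}. t i j \<in> set (e i j)"
    and \<delta>: "\<forall>i\<in>{1..r}. \<forall>j\<in>{1..k i}. \<delta> i j \<in> R \<and> \<tau> (\<delta> i j) 1 = t i j"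
    and E: "\<forall>i\<in>{1..<r}. \<forall>j\<in>{1..k i}.
        E i j = \<delta> i j \<otimes>\<^bsub>G\<^esub> \<gamma> i [^]\<^bsub>G\<^esub> length (e i j) \<otimes>\<^bsub>G\<^esub> inv\<^bsub>G\<^esub> (\<delta> i j)"
    and W: "\<forall>j\<in>{1..k r}.
        W j = \<delta> r j \<otimes>\<^bsub>G\<^esub> \<gamma> r [^]\<^bsub>G\<^esub> length (e r j) \<otimes>\<^bsub>G\<^esub> inv\<^bsub>G\<^esub> (\<delta> r j)"
  shows "(\<forall>i\<in>{1..<r}. \<forall>j\<in>{1..k i}. E i j \<in> H)
    \<and> (\<forall>j\<in>{1..k r}. W j \<in> H \<and>
        W j = \<delta> r j
          \<otimes>\<^bsub>G\<^esub> foldr (\<lambda>i x. inv\<^bsub>G\<^esub> (\<gamma> i) \<otimes>\<^bsub>G\<^esub> x) (rev [1..<r]) \<one>\<^bsub>G\<^esub> [^]\<^bsub>G\<^esub> length (e r j)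
          \<otimes>\<^bsub>G\<^esub> inv\<^bsub>G\<^esub> (\<delta> r j))
    \<and> induced_map Z f ` puncture_kernel Xop Z f z zs r \<gamma> k e u \<beta>
        = normal_closure (G\<lparr>carrier := H\<rparr>)
            ({E i j | i j. i \<in> {1..<r} \<and> j \<in> {1..k i}} \<union> {W j | j. j \<in> {1..k r}})
    \<and> (\<forall>y\<in>Y.
        (\<exists>!(i, j). i \<in> {1..<r} \<and> j \<in> {1..k i} \<and>
            (y, True) \<in> set (reduced_word (G\<lparr>carrier := H\<rparr>) Y (\<lambda>y. y) (E i j)))
        \<and> (\<exists>!j. j \<in> {1..k r} \<and>
            (y, False) \<in> set (reduced_word (G\<lparr>carrier := H\<rparr>) Y (\<lambda>y. y) (W j))))"
proof -
  have n0: "0 < n" and one_n: "1 \<in> {1..n}" using f(2) by auto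
  have cov: "covering_space Xop f Z"
    using f(1) by (simp add: branched_cover_def Xop Z(1) B(1))
  have "Xop \<inter> f -` {z} = X \<inter> f -` {z}" using Z by (auto simp: Xop)
  then interpret C: labelled_covering Xop f Z z zs n
    by unfold_locales (use cov Z(2) n0 zs in simp_all)
  interpret A: right_action G "{1..n}" \<tau>
    using C.right_action_axioms unfolding G \<tau> .
  \<comment> \<open>With fewer than two branch points \<open>G\<close> would be trivial, and \<open>\<gamma> 1\<close> could not move \<open>1\<close>.\<close>
  have r2: "2 \<le> r"
  proof (rule ccontr)
    assume "\<not> 2 \<le> r"
    then have I: "{1..<r} = {}" by auto
    have "\<exists>w. is_reduced_word G {1..<r} \<gamma> (\<gamma> 1) w"
      using \<gamma>(2) \<gamma>1 unfolding free_basis_def by blast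
    then have "\<gamma> 1 = \<one>\<^bsub>G\<^esub>" unfolding I by (auto simp: is_reduced_word_def word_value_def)
    then show False using \<gamma>1 A.act_one[OF one_n] H by simp
  qed
  have \<gamma>r: "\<gamma> r \<in> carrier G"
  proof -
    \<comment> \<open>An empty class would make the whole product in the relation empty, but the class of the constant
        loop is inhabited.\<close>
    have "\<gamma> r \<noteq> {}"
    proof
      assume empty: "\<gamma> r = {}"
      have "foldr (\<lambda>i x. \<gamma> i \<otimes>\<^bsub>G\<^esub> x) js {} = {}" for js
        by (induction js) (simp_all add: G mult_fundamental_group_empty)
      then have "\<one>\<^bsub>G\<^esub> = {}"
        using \<gamma>(3) r2 empty by (simp add: G mult_fundamental_group_empty)
      moreover have "(\<lambda>_. z) \<in> \<one>\<^bsub>G\<^esub>"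
        using Z(2) by (simp add: G one_fundamental_group mem_path_class const_path)
      ultimately show False by simp
    qed
    moreover have "loop_around_only B z (b r) (\<gamma> r)" using \<gamma>(1) r2 by auto
    ultimately show ?thesis unfolding G Z(1) by (intro loop_around_only_in_carrier)
  qed
  have \<gamma>c: "\<gamma> i \<in> carrier G" if "i \<in> {1..r}" for i
    using that \<gamma>r \<gamma>(2) by (cases "i = r") (auto simp: free_basis_def)
  have dec: "disjoint_cycle_decomposition n (\<tau> (\<gamma> i)) (k i) (e i)" if "i \<in> {1..r}" for i
    using e that by blast
  define d where "d i j = path_class Z (f \<circ> \<beta> i j)" for i j
  have un: "u i j \<in> {1..n}" "t i j \<in> {1..n}" if "i \<in> {1..r}" "j \<in> {1..k i}" for i j
    using cycle_decomposition_subset[OF dec[OF that(1)] that(2)] u t that by blast+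
  have d: "d i j \<in> carrier G" "\<tau> (d i j) 1 = u i j" if "i \<in> {1..r}" "j \<in> {1..k i}" for i j
    using C.monodromy_path_class[OF one_n un(1)[OF that], of "\<beta> i j"] \<beta> that
    unfolding d_def G \<tau> by blast+
  have orbit: "\<exists>a. (\<tau> (\<gamma> i) ^^ a) x = y"
    if "i \<in> {1..r}" "j \<in> {1..k i}" "x \<in> set (e i j)" "y \<in> set (e i j)" for i j x y
    using that(4) unfolding cycle_decomposition_orbit(1)[OF dec[OF that(1)] that(2,3), symmetric] by blast
  interpret F: free_transitive_action G "{1..n}" \<tau> "{1..<r}" \<gamma> 1
  proof unfold_locales
    fix p assume p: "p \<in> {1..n}"
    have 1: "1 \<in> {1..r}" using r2 by auto
    obtain j where j: "j \<in> {1..k 1}" "p \<in> set (e 1 j)"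
      using cycle_decomposition_ex1[OF dec[OF 1] p] by blast
    then obtain a where a: "(\<tau> (\<gamma> 1) ^^ a) (u 1 j) = p" using orbit 1 u by blast
    have "\<tau> (d 1 j \<otimes>\<^bsub>G\<^esub> \<gamma> 1 [^]\<^bsub>G\<^esub> a) 1 = p"
      using d[OF 1 j(1)] \<gamma>c[OF 1] un[OF 1 j(1)] one_n a by (simp add: A.act_mult A.act_pow)
    then show "\<exists>g\<in>carrier G. \<tau> g 1 = p"
      by (rule bexI) (use d(1)[OF 1 j(1)] \<gamma>c[OF 1] in simp)
  qed (use \<gamma>(2) one_n in auto)
  have Yed: "Y = F.edge ` F.proper_edges" unfolding Y H by (rule F.schreier_basis_eq)
  have \<delta>rep: "\<delta> i j = F.rep (t i j)" if "i \<in> {1..r}" "j \<in> {1..k i}" for i j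
  proof -
    have "\<delta> i j \<in> F.rep ` {1..n}" "\<tau> (\<delta> i j) 1 = t i j"
      using \<delta> that F.transversal_eq unfolding R H by blast+
    then show ?thesis using F.rep(2) by auto
  qed
  have \<delta>c: "\<delta> i j \<in> carrier G" "\<tau> (\<delta> i j) 1 = t i j" if "i \<in> {1..r}" "j \<in> {1..k i}" for i j
    using F.rep[OF un(2)[OF that]] \<delta>rep[OF that] by simp_all
  have root: "(\<tau> (\<gamma> i) ^^ length (e i j)) x = x"
    if "i \<in> {1..r}" "j \<in> {1..k i}" "x \<in> set (e i j)" for i j x
    using cycle_decomposition_orbit(2)[OF dec[OF that(1)] that(2,3)] .
  have tm: "t i j \<in> set (e i j)" "u i j \<in> set (e i j)" if "i \<in> {1..r}" "j \<in> {1..k i}" for i j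
    using t u that by blast+
  have \<gamma>r_word: "\<gamma> r = F.wv (map (\<lambda>i. (i, False)) (rev [1..<r]))"
    by (rule F.last_generator) (use r2 \<gamma>r \<gamma>(3) in auto)

  define V where "V i j = \<delta> i j \<otimes>\<^bsub>G\<^esub> \<gamma> i [^]\<^bsub>G\<^esub> length (e i j) \<otimes>\<^bsub>G\<^esub> inv\<^bsub>G\<^esub> (\<delta> i j)" for i j
  define U where "U i j = d i j \<otimes>\<^bsub>G\<^esub> \<gamma> i [^]\<^bsub>G\<^esub> length (e i j) \<otimes>\<^bsub>G\<^esub> inv\<^bsub>G\<^esub> (d i j)" for i j
  have EV: "E i j = V i j" if "i \<in> {1..<r}" "j \<in> {1..k i}" for i j
    using E that by (simp add: V_def)
  have WV: "W j = V r j" if "j \<in> {1..k r}" for j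
    using W that by (simp add: V_def)
  have pow_fix: "\<gamma> i [^]\<^bsub>G\<^esub> length (e i j) \<in> carrier G" "\<tau> (\<gamma> i [^]\<^bsub>G\<^esub> length (e i j)) x = x"
    if "i \<in> {1..r}" "j \<in> {1..k i}" "x \<in> set (e i j)" for i j x
    using \<gamma>c[OF that(1)] root[OF that] cycle_decomposition_subset[OF dec[OF that(1)] that(2,3)]
    by (simp_all add: A.act_pow)
  have VH: "V i j \<in> H" if "i \<in> {1..r}" "j \<in> {1..k i}" for i j
    unfolding V_def H
    by (rule F.in_stabilizer_conj[OF un(2)[OF that] \<delta>c[OF that] pow_fix[OF that tm(1)[OF that]]])
  have UH: "U i j \<in> H" if "i \<in> {1..r}" "j \<in> {1..k i}" for i j
    unfolding U_def H
    by (rule F.in_stabilizer_conj[OF un(1)[OF that] d[OF that] pow_fix[OF that tm(2)[OF that]]])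

  have 1: "\<forall>i\<in>{1..<r}. \<forall>j\<in>{1..k i}. E i j \<in> H" using EV VH by simp
  have 2: "\<forall>j\<in>{1..k r}. W j \<in> H \<and>
        W j = \<delta> r j
          \<otimes>\<^bsub>G\<^esub> foldr (\<lambda>i x. inv\<^bsub>G\<^esub> (\<gamma> i) \<otimes>\<^bsub>G\<^esub> x) (rev [1..<r]) \<one>\<^bsub>G\<^esub> [^]\<^bsub>G\<^esub> length (e r j)
          \<otimes>\<^bsub>G\<^esub> inv\<^bsub>G\<^esub> (\<delta> r j)"
    using WV VH r2 unfolding F.foldr_inv_gen \<gamma>r_word[symmetric] by (simp add: V_def)

  let ?K = "G\<lparr>carrier := H\<rparr>"
  have subH: "subgroup H G" unfolding H by (rule A.subgroup_stabilizer[OF one_n])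
  interpret K: group ?K by (rule subgroup.subgroup_is_group[OF subH A.group_axioms])
  have invK: "inv\<^bsub>?K\<^esub> h = inv\<^bsub>G\<^esub> h" if "h \<in> H" for h
    by (rule A.m_inv_consistent[OF subH that])
  have conj: "\<exists>h\<in>carrier ?K. a' = h \<otimes>\<^bsub>?K\<^esub> a \<otimes>\<^bsub>?K\<^esub> inv\<^bsub>?K\<^esub> h"
    if ij: "i \<in> {1..r}" "j \<in> {1..k i}"
      and g: "g \<in> carrier G" "\<tau> g 1 \<in> set (e i j)" "g' \<in> carrier G" "\<tau> g' 1 \<in> set (e i j)"
      and a: "a = g \<otimes>\<^bsub>G\<^esub> \<gamma> i [^]\<^bsub>G\<^esub> length (e i j) \<otimes>\<^bsub>G\<^esub> inv\<^bsub>G\<^esub> g"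
      and a': "a' = g' \<otimes>\<^bsub>G\<^esub> \<gamma> i [^]\<^bsub>G\<^esub> length (e i j) \<otimes>\<^bsub>G\<^esub> inv\<^bsub>G\<^esub> g'"
    for i j g g' a a'
  proof -
    obtain c where "(\<tau> (\<gamma> i) ^^ c) (\<tau> g 1) = \<tau> g' 1" using orbit ij g by blast
    then have "\<tau> g' 1 = \<tau> (g \<otimes>\<^bsub>G\<^esub> \<gamma> i [^]\<^bsub>G\<^esub> c) 1"
      using A.act_mult[OF g(1) A.nat_pow_closed[OF \<gamma>c[OF ij(1)]] one_n]
        A.act_pow(1)[OF \<gamma>c[OF ij(1)] A.act_closed[OF g(1) one_n]] by simp
    from F.conj_independent_of_path[OF g(1,3) \<gamma>c[OF ij(1)] this, of "length (e i j)"]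
    obtain h where "h \<in> H" "a' = h \<otimes>\<^bsub>G\<^esub> a \<otimes>\<^bsub>G\<^esub> inv\<^bsub>G\<^esub> h"
      unfolding a a' H by blast
    then show ?thesis using invK by auto
  qed
  let ?S = "{path_class Xop (\<beta> i j +++ q +++ reversepath (\<beta> i j)) | i j q.
          i \<in> {1..r} \<and> j \<in> {1..k i} \<and>
          is_lift Xop f (\<gamma> i [^]\<^bsub>fundamental_group Z z\<^esub> length (e i j)) (zs (u i j)) q}"
  have lasso: "path_class Xop (\<beta> i j +++ q +++ reversepath (\<beta> i j)) \<in> carrier (fundamental_group Xop (zs 1))"
    "induced_map Z f (path_class Xop (\<beta> i j +++ q +++ reversepath (\<beta> i j))) = U i j"
    if "i \<in> {1..r}" "j \<in> {1..k i}"
      "is_lift Xop f (\<gamma> i [^]\<^bsub>fundamental_group Z z\<^esub> length (e i j)) (zs (u i j)) q" for i j q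
    using C.lasso[OF un(1)[OF that(1,2)] pow_fix[OF that(1,2) tm(2)[OF that(1,2)], unfolded G \<tau>]
        _ _ _ _ that(3), of "\<beta> i j"] \<beta> that(1,2)
    unfolding U_def d_def G by blast+
  have lift: "\<exists>q. is_lift Xop f (\<gamma> i [^]\<^bsub>fundamental_group Z z\<^esub> length (e i j)) (zs (u i j)) q"
    if "i \<in> {1..r}" "j \<in> {1..k i}" for i j
    using C.lift_exists[OF pow_fix(1)[OF that tm(2)[OF that], unfolded G] un(1)[OF that]] by metis
  have SU: "induced_map Z f ` ?S = {U i j | i j. i \<in> {1..r} \<and> j \<in> {1..k i}}"
  proof (intro equalityI subsetI)
    fix x assume "x \<in> {U i j | i j. i \<in> {1..r} \<and> j \<in> {1..k i}}"
    then obtain i j where ij: "x = U i j" "i \<in> {1..r}" "j \<in> {1..k i}" by blast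
    obtain q where q: "is_lift Xop f (\<gamma> i [^]\<^bsub>fundamental_group Z z\<^esub> length (e i j)) (zs (u i j)) q"
      using lift[OF ij(2,3)] by blast
    have "path_class Xop (\<beta> i j +++ q +++ reversepath (\<beta> i j)) \<in> ?S" using ij(2,3) q by blast
    then show "x \<in> induced_map Z f ` ?S"
      unfolding ij(1) lasso(2)[OF ij(2,3) q, symmetric] by (rule imageI)
  next
    fix x assume "x \<in> induced_map Z f ` ?S"
    then obtain i j q where ij: "i \<in> {1..r}" "j \<in> {1..k i}"
      and q: "is_lift Xop f (\<gamma> i [^]\<^bsub>fundamental_group Z z\<^esub> length (e i j)) (zs (u i j)) q"
      and x: "x = induced_map Z f (path_class Xop (\<beta> i j +++ q +++ reversepath (\<beta> i j)))"
      by blast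
    show "x \<in> {U i j | i j. i \<in> {1..r} \<and> j \<in> {1..k i}}"
      unfolding x lasso(2)[OF ij q] using ij by blast
  qed
  have "induced_map Z f ` puncture_kernel Xop Z f z zs r \<gamma> k e u \<beta> = normal_closure ?K (induced_map Z f ` ?S)"
    unfolding puncture_kernel_def
  proof (rule group.normal_closure_iso_image[OF C.group_PC K.group_axioms])
    show "induced_map Z f \<in> iso (fundamental_group Xop (zs 1)) ?K"
      using C.induced_map_iso unfolding H G \<tau> .
    show "?S \<subseteq> carrier (fundamental_group Xop (zs 1))" using lasso(1) by blast
  qed
  also have "\<dots> = normal_closure ?K {V i j | i j. i \<in> {1..r} \<and> j \<in> {1..k i}}"
    unfolding SU
  proof (rule equalityI; rule K.normal_closure_conj_mono)
    show "{V i j | i j. i \<in> {1..r} \<and> j \<in> {1..k i}} \<subseteq> carrier ?K"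
      "{U i j | i j. i \<in> {1..r} \<and> j \<in> {1..k i}} \<subseteq> carrier ?K"
      using VH UH by auto
  next
    fix x assume "x \<in> {U i j | i j. i \<in> {1..r} \<and> j \<in> {1..k i}}"
    then obtain i j where ij: "x = U i j" "i \<in> {1..r}" "j \<in> {1..k i}" by blast
    have "\<exists>h\<in>carrier ?K. U i j = h \<otimes>\<^bsub>?K\<^esub> V i j \<otimes>\<^bsub>?K\<^esub> inv\<^bsub>?K\<^esub> h"
      using conj[OF ij(2,3) \<delta>c(1)[OF ij(2,3)] _ d(1)[OF ij(2,3)] _ V_def U_def]
        \<delta>c(2)[OF ij(2,3)] d(2)[OF ij(2,3)] tm[OF ij(2,3)] by simp
    then show "\<exists>b\<in>{V i j | i j. i \<in> {1..r} \<and> j \<in> {1..k i}}. \<exists>h\<in>carrier ?K.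
        x = h \<otimes>\<^bsub>?K\<^esub> b \<otimes>\<^bsub>?K\<^esub> inv\<^bsub>?K\<^esub> h" using ij by blast
  next
    fix x assume "x \<in> {V i j | i j. i \<in> {1..r} \<and> j \<in> {1..k i}}"
    then obtain i j where ij: "x = V i j" "i \<in> {1..r}" "j \<in> {1..k i}" by blast
    have "\<exists>h\<in>carrier ?K. V i j = h \<otimes>\<^bsub>?K\<^esub> U i j \<otimes>\<^bsub>?K\<^esub> inv\<^bsub>?K\<^esub> h"
      using conj[OF ij(2,3) d(1)[OF ij(2,3)] _ \<delta>c(1)[OF ij(2,3)] _ U_def V_def]
        \<delta>c(2)[OF ij(2,3)] d(2)[OF ij(2,3)] tm[OF ij(2,3)] by simp
    then show "\<exists>b\<in>{U i j | i j. i \<in> {1..r} \<and> j \<in> {1..k i}}. \<exists>h\<in>carrier ?K.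
        x = h \<otimes>\<^bsub>?K\<^esub> b \<otimes>\<^bsub>?K\<^esub> inv\<^bsub>?K\<^esub> h" using ij by blast
  qed
  also have "{V i j | i j. i \<in> {1..r} \<and> j \<in> {1..k i}} =
      {E i j | i j. i \<in> {1..<r} \<and> j \<in> {1..k i}} \<union> {W j | j. j \<in> {1..k r}}"
  proof (intro equalityI subsetI)
    fix x assume "x \<in> {V i j | i j. i \<in> {1..r} \<and> j \<in> {1..k i}}"
    then obtain i j where ij: "x = V i j" "i \<in> {1..r}" "j \<in> {1..k i}" by blast
    show "x \<in> {E i j | i j. i \<in> {1..<r} \<and> j \<in> {1..k i}} \<union> {W j | j. j \<in> {1..k r}}"
    proof (cases "i = r")
      case True
      then show ?thesis using ij WV by blast
    next
      case False
      then have "i \<in> {1..<r}" using ij by auto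
      then show ?thesis using ij EV by blast
    qed
  next
    fix x assume "x \<in> {E i j | i j. i \<in> {1..<r} \<and> j \<in> {1..k i}} \<union> {W j | j. j \<in> {1..k r}}"
    then consider i j where "x = V i j" "i \<in> {1..<r}" "j \<in> {1..k i}" | j where "x = V r j" "j \<in> {1..k r}"
      using EV WV by blast
    then show "x \<in> {V i j | i j. i \<in> {1..r} \<and> j \<in> {1..k i}}"
    proof cases
      case (1 i j)
      then have "i \<in> {1..r}" by auto
      then show ?thesis using 1 by blast
    next
      case (2 j)
      have "r \<in> {1..r}" using r2 by auto
      then show ?thesis using 2 by blast
    qed
  qed
  finally have 3: "induced_map Z f ` puncture_kernel Xop Z f z zs r \<gamma> k e u \<beta>
        = normal_closure ?K
            ({E i j | i j. i \<in> {1..<r} \<and> j \<in> {1..k i}} \<union> {W j | j. j \<in> {1..k r}})" .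

  have 4: "(\<exists>!(i, j). i \<in> {1..<r} \<and> j \<in> {1..k i} \<and>
            (y, True) \<in> set (reduced_word ?K Y (\<lambda>y. y) (E i j)))
        \<and> (\<exists>!j. j \<in> {1..k r} \<and>
            (y, False) \<in> set (reduced_word ?K Y (\<lambda>y. y) (W j)))" if yY: "y \<in> Y" for y
  proof -
    obtain q i' where D: "(q, i') \<in> F.proper_edges" and y: "y = F.edge (q, i')"
      using yY unfolding Yed by (metis imageE surj_pair)
    have q: "q \<in> {1..n}" and i': "i' \<in> {1..<r}" using D unfolding F.proper_edges_def by blast+
    have pos: "(y, True) \<in> set (reduced_word ?K Y (\<lambda>y. y) (E i j)) \<longleftrightarrow> i' = i \<and> q \<in> set (e i j)"
      if ij: "i \<in> {1..<r}" "j \<in> {1..k i}" for i j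
    proof -
      have i: "i \<in> {1..r}" using ij(1) by auto
      show ?thesis
        using F.positive_letter_iff[OF ij(1) un(2)[OF i ij(2)] root[OF i ij(2) tm(1)[OF i ij(2)]] D]
        unfolding cycle_decomposition_orbit(1)[OF dec[OF i] ij(2) tm(1)[OF i ij(2)]]
        by (simp only: EV[OF ij] V_def \<delta>rep[OF i ij(2)] Yed y H)
    qed
    have i'r: "i' \<in> {1..r}" using i' by auto
    obtain j where j: "j \<in> {1..k i'}" "q \<in> set (e i' j)"
        "\<And>j'. j' \<in> {1..k i'} \<Longrightarrow> q \<in> set (e i' j') \<Longrightarrow> j' = j"
      using cycle_decomposition_ex1[OF dec[OF i'r] q] by blast
    have E1: "\<exists>!(i, j). i \<in> {1..<r} \<and> j \<in> {1..k i} \<and>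
            (y, True) \<in> set (reduced_word ?K Y (\<lambda>y. y) (E i j))"
    proof (rule ex1I[of _ "(i', j)"])
      show "case (i', j) of (i, j) \<Rightarrow> i \<in> {1..<r} \<and> j \<in> {1..k i} \<and>
            (y, True) \<in> set (reduced_word ?K Y (\<lambda>y. y) (E i j))"
        using i' j(1,2) pos[OF i' j(1)] by blast
      fix x assume x: "case x of (i, j) \<Rightarrow> i \<in> {1..<r} \<and> j \<in> {1..k i} \<and>
            (y, True) \<in> set (reduced_word ?K Y (\<lambda>y. y) (E i j))"
      obtain i0 j0 where x0: "x = (i0, j0)" by (cases x)
      then have "i0 \<in> {1..<r}" "j0 \<in> {1..k i0}" "i' = i0 \<and> q \<in> set (e i0 j0)"
        using x pos[of i0 j0] by blast+
      then show "x = (i', j)" using j(3) x0 by blast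
    qed
    \<comment> \<open>\<open>\<tau> h\<close> leads from the start of an edge labelled \<open>i'\<close> back to the point at which the
        reading of \<open>\<gamma> r\<close> that crosses this edge began.\<close>
    define h where "h = inv\<^bsub>G\<^esub> (F.wv (map (\<lambda>i. (i, False)) (takeWhile (\<lambda>j. j \<noteq> i') (rev [1..<r]) @ [i'])))"
    have rr: "r \<in> {1..r}" using r2 by auto
    have neg: "(y, False) \<in> set (reduced_word ?K Y (\<lambda>y. y) (W j)) \<longleftrightarrow> \<tau> h q \<in> set (e r j)"
      if j: "j \<in> {1..k r}" for j
      using F.negative_letter_iff[of "rev [1..<r]" "t r j" q i' "length (e r j)"]
        un(2)[OF rr j] D root[OF rr j tm(1)[OF rr j]]
      unfolding \<gamma>r_word[symmetric] h_def[symmetric]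
        cycle_decomposition_orbit(1)[OF dec[OF rr] j tm(1)[OF rr j]]
      by (simp only: WV[OF j] V_def \<delta>rep[OF rr j] Yed y H) simp
    have "F.wv (map (\<lambda>i. (i, False)) (takeWhile (\<lambda>j. j \<noteq> i') (rev [1..<r]) @ [i'])) \<in> carrier G"
      by (rule F.wv_closed) (use i' in \<open>auto dest: set_takeWhileD\<close>)
    then have "\<tau> h q \<in> {1..n}" using q unfolding h_def by (intro A.act_closed) auto
    from cycle_decomposition_ex1[OF dec[OF rr] this]
    have "\<exists>!j. j \<in> {1..k r} \<and> (y, False) \<in> set (reduced_word ?K Y (\<lambda>y. y) (W j))"
      using neg by (metis (no_types, lifting))
    with E1 show ?thesis by blast
  qed
  show ?thesis by (rule conjI[OF 1 conjI[OF 2 conjI[OF 3 ballI[OF 4]]]])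
qed

end
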